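(* Let $p\ge q\ge0$ be integers, and let $0\le i\le q$, $0\le j\le q-i$. Put $(k,l)=(p-i+j,\,q-i-j)$. For $P\in\mathcal{P}_{p,q}(\mathbb{R}^{2m},\mathbb{C})\cap\ker(\Delta_x,\Delta_u)$ define $$\Pi_{i,j}[P]:=\frac{1}{\alpha^{i,j}_{i,j}(k,l)}\,\Pi_{(k,l)}A^iS_x^jP .$$ Then $\Pi_{i,j}$ is the projection $\mathcal{P}_{p,q}\cap\ker(\Delta_x,\Delta_u)\to\mathcal{H}_{p-i+j,q-i-j}$ associated with the decomposition $\mathcal{P}_{p,q}\cap\ker(\Delta_x,\Delta_u)=\bigoplus_{a=0}^{q}\bigoplus_{b=0}^{q-a}C^aS_u^b\mathcal{H}_{p-a+b,q-a-b}$: if $P=\sum_{a,b}C^aS_u^bH^{(a,b)}$ with $H^{(a,b)}\in\mathcal{H}_{p-a+b,q-a-b}$, then $\Pi_{i,j}[P]=H^{(i,j)}$.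
   Context: Fix an integer $m>4$. For $x,u\in\mathbb{R}^m$ let $\mathcal{P}_{p,q}(\mathbb{R}^{2m},\mathbb{C})$ be the complex polynomials homogeneous of degree $p$ in $x$ and $q$ in $u$. Write $|x|^2=\sum x_j^2$, $\langle u,x\rangle=\sum u_jx_j$, $\Delta_x=\sum\partial_{x_j}^2$, $\Delta_u=\sum\partial_{u_j}^2$, $\langle\partial_u,\partial_x\rangle=\sum\partial_{u_j}\partial_{x_j}$, $\langle x,\partial_u\rangle=\sum x_j\partial_{u_j}$, $\langle u,\partial_x\rangle=\sum u_j\partial_{x_j}$, $\ker(D_1,\dots,D_r)=\bigcap\ker D_i$. Every $P\in\mathcal{P}_{p,q}$ can be written uniquely as $P=\sum_{a,b\ge0}|x|^{2a}|u|^{2b}H'_{p-2a,q-2b}$ with $H'_{p-2a,q-2b}\in\mathcal{P}_{p-2a,q-2b}\cap\ker(\Delta_x,\Delta_u)$; let $\pi_{\mathfrak{s}}$ be the linear operator with $\pi_{\mathfrak{s}}P=H'_{p,q}$. On $\ker(\Delta_x,\Delta_u)$ define $S_x=\pi_{\mathfrak{s}}\langle x,\partial_u\rangle$, $S_u=\pi_{\mathfrak{s}}\langle u,\partial_x\rangle$, $A=\pi_{\mathfrak{s}}\langle\partial_u,\partial_x\rangle$, $C=\pi_{\mathfrak{s}}\langle u,x\rangle$ (note $A^iS_x^j$ maps bidegree $(p,q)$ to $(p-i+j,q-i-j)$). Simplicial harmonics: $\mathcal{H}_{a,b}=\mathcal{P}_{a,b}\cap\ker(\Delta_x,\Delta_u,\langle\partial_u,\partial_x\rangle,\langle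 x,\partial_u\rangle)$ for $a\ge b\ge0$. Rising factorial $\alpha^{(j)}=\alpha(\alpha+1)\cdots(\alpha+j-1)$, falling factorial $\alpha_{(j)}=\alpha(\alpha-1)\cdots(\alpha-j+1)$, both $1$ for $j=0$. For $k\ge l\ge0$, $\Pi_{(k,l)}=\sum_{a,b\ge0}\beta_{a,b}(k,l)C^aS_u^bA^aS_x^b$ on $\mathcal{P}_{k,l}\cap\ker(\Delta_x,\Delta_u)$ with $\beta_{a,b}(k,l)=\frac{(-1)^{a+b}}{a!\,b!}\frac{(k+\frac m2-a+b-1)(l+\frac m2-b-3)_{(a)}}{(k+\frac m2+b-1)(l+\frac m2-3)_{(a)}(k+l+m-4)_{(a)}(k-l+2)^{(b)}}$. Finally $$\alpha^{i,j}_{i,j}(k,l)=(i)_{(i)}(j)_{(j)}(k-l-j+1)^{(j)}\frac{(k+\frac m2+i-1)_{(i)}}{(k+\frac m2+i-2)_{(i)}}\cdot\frac{(l+\frac m2+j-2)_{(j)}\,(l+\frac m2+i-2)_{(i)}}{(l+\frac m2+i+j-2)_{(j)}\,(l+\frac m2+i-2)_{(i)}}\,(k+l+m+i-3)_{(i)}.$$ *)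

theory Defs
  imports Complex_Main "HOL-Library.Poly_Mapping"
begin

text \<open>Complex polynomials in the 2m real variables x_0..x_{m-1}, u_0..u_{m-1}.
  Variable x_j has index j, variable u_j has index m + j.  A monomial is an
  exponent vector (nat =>0 nat), a polynomial a finitely supported map from
  monomials to complex coefficients (with the convolution product).\<close>

type_synonym mono = "nat \<Rightarrow>\<^sub>0 nat"
type_synonym cpoly = "mono \<Rightarrow>\<^sub>0 complex"

definition var :: "nat \<Rightarrow> cpoly" where
  "var v = Poly_Mapping.single (Poly_Mapping.single v 1) 1"

definition Xv :: "nat \<Rightarrow> nat \<Rightarrow> cpoly" where "Xv m j = var j"
definition Uv :: "nat \<Rightarrow> nat \<Rightarrow> cpoly" where "Uv m j = var (m + j)"

definition pderiv_v :: "nat \<Rightarrow> cpoly \<Rightarrow> cpoly" where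
  "pderiv_v v P = (\<Sum>(mon::mono)\<in>Poly_Mapping.keys P.
      Poly_Mapping.single (mon - Poly_Mapping.single v 1)
        (of_nat (Poly_Mapping.lookup mon v) * Poly_Mapping.lookup P mon))"

definition dx :: "nat \<Rightarrow> nat \<Rightarrow> cpoly \<Rightarrow> cpoly" where "dx m j = pderiv_v j"
definition du :: "nat \<Rightarrow> nat \<Rightarrow> cpoly \<Rightarrow> cpoly" where "du m j = pderiv_v (m + j)"

definition bihom :: "nat \<Rightarrow> nat \<Rightarrow> nat \<Rightarrow> cpoly \<Rightarrow> bool" where
  "bihom m p q P \<longleftrightarrow> (\<forall>(mon::mono)\<in>Poly_Mapping.keys P.
      (\<forall>v. 2 * m \<le> v \<longrightarrow> Poly_Mapping.lookup mon v = 0) \<and>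
      (\<Sum>j<m. Poly_Mapping.lookup mon j) = p \<and> (\<Sum>j<m. Poly_Mapping.lookup mon (m + j)) = q)"

definition Lap_x :: "nat \<Rightarrow> cpoly \<Rightarrow> cpoly" where
  "Lap_x m P = (\<Sum>j<m. dx m j (dx m j P))"
definition Lap_u :: "nat \<Rightarrow> cpoly \<Rightarrow> cpoly" where
  "Lap_u m P = (\<Sum>j<m. du m j (du m j P))"
definition du_dx :: "nat \<Rightarrow> cpoly \<Rightarrow> cpoly" where
  "du_dx m P = (\<Sum>j<m. du m j (dx m j P))"
definition x_du :: "nat \<Rightarrow> cpoly \<Rightarrow> cpoly" where
  "x_du m P = (\<Sum>j<m. Xv m j * du m j P)"
definition u_dx :: "nat \<Rightarrow> cpoly \<Rightarrow> cpoly" where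
  "u_dx m P = (\<Sum>j<m. Uv m j * dx m j P)"

definition xsq :: "nat \<Rightarrow> cpoly" where "xsq m = (\<Sum>j<m. Xv m j ^ 2)"
definition usq :: "nat \<Rightarrow> cpoly" where "usq m = (\<Sum>j<m. Uv m j ^ 2)"
definition ux :: "nat \<Rightarrow> cpoly" where "ux m = (\<Sum>j<m. Uv m j * Xv m j)"

definition harm2 :: "nat \<Rightarrow> nat \<Rightarrow> nat \<Rightarrow> cpoly \<Rightarrow> bool" where
  "harm2 m p q H \<longleftrightarrow> bihom m p q H \<and> Lap_x m H = 0 \<and> Lap_u m H = 0"

definition simp_harm :: "nat \<Rightarrow> nat \<Rightarrow> nat \<Rightarrow> cpoly \<Rightarrow> bool" where
  "simp_harm m a b H \<longleftrightarrow> bihom m a b H \<and> Lap_x m H = 0 \<and> Lap_u m H = 0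
      \<and> du_dx m H = 0 \<and> x_du m H = 0"

definition pi_s :: "nat \<Rightarrow> cpoly \<Rightarrow> cpoly" where
  "pi_s m P = (THE H. \<exists>p q G. bihom m p q P \<and>
      (\<forall>a\<le>p div 2. \<forall>b\<le>q div 2. harm2 m (p - 2*a) (q - 2*b) (G a b)) \<and>
      P = (\<Sum>a\<le>p div 2. \<Sum>b\<le>q div 2. xsq m ^ a * usq m ^ b * G a b) \<and>
      H = G 0 0)"

definition S_x :: "nat \<Rightarrow> cpoly \<Rightarrow> cpoly" where "S_x m P = pi_s m (x_du m P)"
definition S_u :: "nat \<Rightarrow> cpoly \<Rightarrow> cpoly" where "S_u m P = pi_s m (u_dx m P)"
definition A_op :: "nat \<Rightarrow> cpoly \<Rightarrow> cpoly" where "A_op m P = pi_s m (du_dx m P)"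
definition C_op :: "nat \<Rightarrow> cpoly \<Rightarrow> cpoly" where "C_op m P = pi_s m (ux m * P)"

definition falling :: "real \<Rightarrow> nat \<Rightarrow> real" where
  "falling a j = (\<Prod>t<j. a - of_nat t)"

definition beta_coef :: "nat \<Rightarrow> nat \<Rightarrow> nat \<Rightarrow> nat \<Rightarrow> nat \<Rightarrow> real" where
  "beta_coef m k l a b =
     (-1) ^ (a + b) / (fact a * fact b) *
     ((real k + real m / 2 - real a + real b - 1) *
        falling (real l + real m / 2 - real b - 3) a) /
     ((real k + real m / 2 + real b - 1) *
        falling (real l + real m / 2 - 3) a *
        falling (real k + real l + real m - 4) a *
        pochhammer (real k - real l + 2) b)"

text \<open>Pi_{(k,l)}; the terms with a > l or b > l vanish on P_{k,l}, since
  A^a S_x^b lowers the u-degree by a + b.\<close>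
definition Pi_kl :: "nat \<Rightarrow> nat \<Rightarrow> nat \<Rightarrow> cpoly \<Rightarrow> cpoly" where
  "Pi_kl m k l P = (\<Sum>a\<le>l. \<Sum>b\<le>l.
      Poly_Mapping.map (\<lambda>c. complex_of_real (beta_coef m k l a b) * c)
        ((C_op m ^^ a) ((S_u m ^^ b) ((A_op m ^^ a) ((S_x m ^^ b) P)))))"

definition alpha_coef :: "nat \<Rightarrow> nat \<Rightarrow> nat \<Rightarrow> nat \<Rightarrow> nat \<Rightarrow> real" where
  "alpha_coef m i j k l =
     falling (real i) i * falling (real j) j *
     pochhammer (real k - real l - real j + 1) j *
     (falling (real k + real m / 2 + real i - 1) i /
        falling (real k + real m / 2 + real i - 2) i) *
     ((falling (real l + real m / 2 + real j - 2) j *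
         falling (real l + real m / 2 + real i - 2) i) /
      (falling (real l + real m / 2 + real i + real j - 2) j *
         falling (real l + real m / 2 + real i - 2) i)) *
     falling (real k + real l + real m + real i - 3) i"

definition Pi_ij :: "nat \<Rightarrow> nat \<Rightarrow> nat \<Rightarrow> nat \<Rightarrow> nat \<Rightarrow> cpoly \<Rightarrow> cpoly" where
  "Pi_ij m p q i j P =
     (let k = p - i + j; l = q - i - j in
      Poly_Mapping.map (\<lambda>c. complex_of_real (1 / alpha_coef m i j k l) * c)
        (Pi_kl m k l ((A_op m ^^ i) ((S_x m ^^ j) P))))"

end

theory Submission
  imports Defs
begin

text \<open>
  On harmonic polynomials the projected operators have closed forms, obtained by subtracting explicit
  multiples of \<open>|x|\<^sup>2\<close> and \<open>|u|\<^sup>2\<close>; two harmonic polynomials that agree modulo the ideal generated by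
  \<open>|x|\<^sup>2\<close> and \<open>|u|\<^sup>2\<close> are equal, because multiplication by these is adjoint to the Laplacians for the
  Fischer inner product.  This turns the relations between \<open>S_x\<close>, \<open>S_u\<close>, \<open>A\<close>, \<open>C\<close> into computations
  modulo the ideal.  For a simplicial harmonic \<open>H\<close> they show that each of the four operators maps
  \<open>v a b = C\<^sup>a S_u\<^sup>b H\<close> to an explicit multiple of a neighbouring vector.  Hence \<open>A\<^sup>i S_x\<^sup>j\<close> maps \<open>v a b\<close> to
  a multiple of \<open>v (a - i) (b - j)\<close>, which is \<open>\<alpha> H\<close> for \<open>(a, b) = (i, j)\<close>, and it remains to see that
  \<open>\<Pi>\<close> kills \<open>v a b\<close> unless \<open>a = b = 0\<close>: its eigenvalue there is a hypergeometric double sum, which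
  telescopes.
\<close>

section \<open>Derivations and scalars\<close>

text \<open>In general, moving \<open>S_x\<close> past \<open>S_u\<close> also produces a multiple
  of \<open>C_op\<close> after \<open>A_op\<close>, and moving \<open>A_op\<close> past
  \<open>C_op\<close> one of \<open>S_u\<close> after \<open>S_x\<close>. The order of the operators
  in \<open>v a b\<close> avoids these terms: the first relation is needed only on vectors killed by
  \<open>A_op\<close>, the second only on vectors killed by \<open>S_x\<close>. Accordingly
  \<open>A_op\<close> is computed on \<open>v a 0\<close>, which \<open>S_x\<close> kills, and
  carried to \<open>v a b\<close> along \<open>S_u\<close>; this costs a division by a coefficient
  that is nonzero as long as the x-degree of the vector is not exhausted. The other obstacle is
  denominators, which are linear in the degrees. A nonzero polynomial has nonnegative degrees, and
  together with m > 4 this makes most of them positive. Those of the rising factorial in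
  \<open>beta_coef\<close> need in addition that the target bidegree (K, L) satisfies L \<le> K,
  that is l + 2 b \<le> k. The few that can still vanish sit at the ends of the summation ranges,
  next to a zero numerator.\<close>

abbreviation ev :: "nat \<Rightarrow> mono" where "ev v \<equiv> Poly_Mapping.single v 1"

lemma cpoly_induct [case_names single add]:
  fixes P :: cpoly
  assumes "\<And>mon c. Q (Poly_Mapping.single mon c)"
    and "\<And>P R. Q P \<Longrightarrow> Q R \<Longrightarrow> Q (P + R)"
  shows "Q P"
proof (induction P rule: update_induct)
  case const
  show ?case using assms(1)[of 0 0] by simp
next
  case (update f a b)
  have "Poly_Mapping.update a b f = f + Poly_Mapping.single a b"
    using update(1)
    by (intro poly_mapping_eqI)
      (auto simp: lookup_update lookup_add lookup_single when_def in_keys_iff)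
  then show ?case using assms update by simp
qed

text \<open>Seen from the target monomial there is no truncated subtraction: raising the exponent of
  \<open>v\<close> is injective, lowering it is not. Linearity and commutation then become
  arithmetic on coefficients.\<close>

lemma lookup_pderiv_v:
  "Poly_Mapping.lookup (pderiv_v v P) mon
    = of_nat (Poly_Mapping.lookup mon v + 1) * Poly_Mapping.lookup P (mon + ev v)"
proof -
  \<comment> \<open>\<open>mon' - ev v\<close> truncates when the exponent of \<open>v\<close> in
    \<open>mon'\<close> is zero, but then the factor in front is zero as well.\<close>
  have eq: "(of_nat (Poly_Mapping.lookup mon' v) * Poly_Mapping.lookup P mon' when mon' - ev v = mon)
      = (of_nat (Poly_Mapping.lookup mon v + 1) * Poly_Mapping.lookup P (mon + ev v) when mon' = mon + ev v)"
    for mon'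
  proof (cases "Poly_Mapping.lookup mon' v = 0")
    case True
    then have "mon' \<noteq> mon + ev v" by (auto simp: lookup_add)
    then show ?thesis using True by simp
  next
    case False
    have "mon' = (mon' - ev v) + ev v"
      using False
      by (intro poly_mapping_eqI) (auto simp: lookup_add minus_poly_mapping.rep_eq lookup_single when_def)
    then have "mon' - ev v = mon \<longleftrightarrow> mon' = mon + ev v" by auto
    then show ?thesis by (auto simp: when_def lookup_add)
  qed
  show ?thesis
    unfolding pderiv_v_def lookup_sum lookup_single eq
    by (auto simp: when_def sum.delta in_keys_iff)
qed

lemma pderiv_v_add: "pderiv_v v (P + Q) = pderiv_v v P + pderiv_v v Q"
  by (intro poly_mapping_eqI) (simp add: lookup_pderiv_v lookup_add algebra_simps)

lemma pderiv_v_zero [simp]: "pderiv_v v 0 = 0"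
  by (intro poly_mapping_eqI) (simp add: lookup_pderiv_v)

lemma pderiv_v_sum: "pderiv_v v (\<Sum>i\<in>I. f i) = (\<Sum>i\<in>I. pderiv_v v (f i))"
  by (induction I rule: infinite_finite_induct) (auto simp: pderiv_v_add)

lemma pderiv_v_diff: "pderiv_v v (P - Q) = pderiv_v v P - pderiv_v v Q"
  by (intro poly_mapping_eqI) (simp add: lookup_pderiv_v lookup_minus algebra_simps)

lemma pderiv_v_commute: "pderiv_v v (pderiv_v w P) = pderiv_v w (pderiv_v v P)"
  by (intro poly_mapping_eqI)
    (auto simp: lookup_pderiv_v lookup_add lookup_single when_def add_ac)

lemma pderiv_v_single:
  "pderiv_v v (Poly_Mapping.single mon c)
    = Poly_Mapping.single (mon - ev v) (of_nat (Poly_Mapping.lookup mon v) * c)"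
  by (simp add: pderiv_v_def)

text \<open>The Weyl algebra relation, from which the commutators with multiplication operators are
  built.\<close>

lemma pderiv_v_var_mult:
  "pderiv_v v (var w * P) = (if v = w then P else 0) + var w * pderiv_v v P"
proof (induction P rule: cpoly_induct)
  case (single mon c)
  show ?case
  proof (cases "v = w")
    case True
    have "ev v + mon - ev v = mon"
      by simp
    moreover have "ev v + (mon - ev v) = mon" if "Poly_Mapping.lookup mon v \<noteq> 0"
      using that by (intro poly_mapping_eqI) (auto simp: lookup_add minus_poly_mapping.rep_eq lookup_single when_def)
    ultimately show ?thesis using True
      by (cases "Poly_Mapping.lookup mon v = 0")
        (auto simp: var_def mult_single pderiv_v_single lookup_add single_add[symmetric] algebra_simps)
  next
    case False
    then have "ev w + mon - ev v = ev w + (mon - ev v)"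
      by (intro poly_mapping_eqI) (auto simp: lookup_add minus_poly_mapping.rep_eq lookup_single when_def)
    then show ?thesis using False
      by (auto simp: var_def mult_single pderiv_v_single lookup_add lookup_single)
  qed
next
  case (add P R)
  then show ?case by (simp add: pderiv_v_add algebra_simps)
qed

text \<open>Real scalars are encoded as constant polynomials, so that coefficients live in the same
  commutative ring and ring normalisation handles them.\<close>

definition scal :: "real \<Rightarrow> cpoly" where
  "scal r = Poly_Mapping.single 0 (complex_of_real r)"

lemma scal_0 [simp]: "scal 0 = 0" and scal_1 [simp]: "scal 1 = 1"
  by (simp_all add: scal_def)

lemma scal_add: "scal (r + s) = scal r + scal s"
  and scal_diff: "scal (r - s) = scal r - scal s"
  and scal_mult: "scal (r * s) = scal r * scal s"
  by (simp_all add: scal_def single_add single_diff mult_single)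

lemma scal_of_nat: "scal (of_nat n) = of_nat n"
  by (simp add: scal_def)

lemma scal_numeral: "scal (numeral n) = numeral n"
  by (simp add: scal_def)

lemma scal_mult_cancel:
  assumes "r \<noteq> 0" and "scal r * P = scal r * Q"
  shows "P = Q"
proof -
  have "scal (1 / r) * (scal r * P) = scal (1 / r) * (scal r * Q)"
    using assms(2) by simp
  then show ?thesis
    using assms(1) by (simp add: mult.assoc[symmetric] scal_mult[symmetric])
qed

lemma map_mult_scal:
  "Poly_Mapping.map (\<lambda>c. complex_of_real r * c) P = scal r * P"
  using mult_map_scale_conv_mult[of "complex_of_real r" P] by (simp add: scal_def)

lemma lookup_scal_mult: "Poly_Mapping.lookup (scal r * P) mon = complex_of_real r * Poly_Mapping.lookup P mon"
  unfolding map_mult_scal[symmetric] by (simp add: map.rep_eq when_def)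

lemma pderiv_v_scal_mult: "pderiv_v v (scal r * P) = scal r * pderiv_v v P"
  by (intro poly_mapping_eqI) (simp add: lookup_pderiv_v lookup_scal_mult)

text \<open>The Euler operator of one variable is diagonal on monomials; this turns homogeneity into
  an eigenvalue equation.\<close>

lemma lookup_var_pderiv_v:
  "Poly_Mapping.lookup (var v * pderiv_v v P) mon
    = of_nat (Poly_Mapping.lookup mon v) * Poly_Mapping.lookup P mon"
proof (induction P rule: cpoly_induct)
  case (single mon' c)
  have "ev v + (mon' - ev v) = mon'" if "Poly_Mapping.lookup mon' v \<noteq> 0"
    using that by (intro poly_mapping_eqI) (auto simp: lookup_add minus_poly_mapping.rep_eq lookup_single when_def)
  then show ?case
    by (cases "Poly_Mapping.lookup mon' v = 0")
      (auto simp: var_def mult_single pderiv_v_single lookup_single when_def)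
next
  case (add P R)
  then show ?case by (simp add: pderiv_v_add lookup_add algebra_simps)
qed

section \<open>The Fischer inner product and the Howe dual pair operators\<close>

text \<open>The multi-index factorial over the 2m variables, which is the squared Fischer norm of a
  monomial.\<close>

definition weight :: "nat \<Rightarrow> mono \<Rightarrow> real" where
  "weight m mon = (\<Prod>v<2 * m. fact (Poly_Mapping.lookup mon v))"

definition fischer :: "nat \<Rightarrow> cpoly \<Rightarrow> cpoly \<Rightarrow> complex" where
  "fischer m P Q = (\<Sum>mon\<in>Poly_Mapping.keys P. complex_of_real (weight m mon)
      * Poly_Mapping.lookup P mon * cnj (Poly_Mapping.lookup Q mon))"

lemma fischer_superset:
  assumes "finite S" and "Poly_Mapping.keys P \<subseteq> S"
  shows "fischer m P Q = (\<Sum>mon\<in>S. complex_of_real (weight m mon)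
      * Poly_Mapping.lookup P mon * cnj (Poly_Mapping.lookup Q mon))"
  unfolding fischer_def
  by (rule sum.mono_neutral_left) (use assms in \<open>auto simp: in_keys_iff\<close>)

lemma fischer_add_left: "fischer m (P + R) Q = fischer m P Q + fischer m R Q"
proof -
  let ?S = "Poly_Mapping.keys P \<union> Poly_Mapping.keys R"
  have S: "finite ?S" by simp
  show ?thesis
    unfolding fischer_superset[OF S keys_add] fischer_superset[OF S Un_upper1]
      fischer_superset[OF S Un_upper2]
    by (simp add: lookup_add algebra_simps sum.distrib)
qed

lemma fischer_add_right: "fischer m P (Q + R) = fischer m P Q + fischer m P R"
  by (simp add: fischer_def lookup_add algebra_simps sum.distrib)

lemma fischer_zero [simp]: "fischer m 0 Q = 0" "fischer m P 0 = 0"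
  by (simp_all add: fischer_def)

lemma fischer_sum_left: "fischer m (\<Sum>i\<in>I. f i) Q = (\<Sum>i\<in>I. fischer m (f i) Q)"
  by (induction I rule: infinite_finite_induct) (auto simp: fischer_add_left)

lemma fischer_sum_right: "fischer m P (\<Sum>i\<in>I. f i) = (\<Sum>i\<in>I. fischer m P (f i))"
  by (induction I rule: infinite_finite_induct) (auto simp: fischer_add_right)

text \<open>Raising the exponent of \<open>v\<close> multiplies the factorial weight by exactly the
  number that differentiation brings down.\<close>

lemma fischer_adjoint:
  assumes "v < 2 * m"
  shows "fischer m (var v * P) Q = fischer m P (pderiv_v v Q)"
proof (induction P rule: cpoly_induct)
  case (single mon c)
  have "weight m (mon + ev v) = weight m mon * of_nat (Suc (Poly_Mapping.lookup mon v))"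
  proof -
    let ?f = "\<lambda>mon w. fact (Poly_Mapping.lookup mon w) :: real"
    have r: "weight m mon = ?f mon v * prod (?f mon) ({..<2*m} - {v})" for mon
      unfolding weight_def using assms by (simp add: prod.remove)
    have "prod (?f (mon + ev v)) ({..<2*m} - {v}) = prod (?f mon) ({..<2*m} - {v})"
      by (rule prod.cong) (auto simp: lookup_add lookup_single when_def)
    then show ?thesis unfolding r by (simp add: lookup_add)
  qed
  moreover have "fischer m (Poly_Mapping.single mon c) R
      = complex_of_real (weight m mon) * c * cnj (Poly_Mapping.lookup R mon)" for mon R
    by (cases "c = 0") (auto simp: fischer_def)
  ultimately show ?case
    by (simp add: var_def mult_single lookup_pderiv_v add.commute algebra_simps)
next
  case (add P R)
  then show ?case by (simp add: fischer_add_left distrib_left)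
qed

lemma fischer_definite:
  assumes "fischer m P P = 0"
  shows "P = 0"
proof (rule ccontr)
  assume "P \<noteq> 0"
  have pos: "weight m mon > 0" for mon
    by (simp add: weight_def prod_pos)
  have "fischer m P P = complex_of_real (\<Sum>mon\<in>Poly_Mapping.keys P. weight m mon
      * (cmod (Poly_Mapping.lookup P mon))\<^sup>2)"
    unfolding fischer_def of_real_sum
    by (rule sum.cong) (simp_all only: of_real_mult complex_norm_square mult.assoc)
  moreover have "(\<Sum>mon\<in>Poly_Mapping.keys P. weight m mon
      * (cmod (Poly_Mapping.lookup P mon))\<^sup>2) > 0"
    using \<open>P \<noteq> 0\<close> pos
    by (intro sum_pos) (auto simp: in_keys_iff)
  ultimately show False using assms by (metis of_real_eq_0_iff less_irrefl)
qed

text \<open>The offsets \<open>s\<close>, \<open>t\<close> are \<open>0\<close> for the block of the \<open>x\<close>-variables and \<open>m\<close> for the block of the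
  \<open>u\<close>-variables, so that every operator relation is proved once for both roles of \<open>x\<close> and \<open>u\<close>.\<close>

definition Eop :: "nat \<Rightarrow> nat \<Rightarrow> nat \<Rightarrow> cpoly \<Rightarrow> cpoly" where
  "Eop m s t P = (\<Sum>j<m. var (s + j) * pderiv_v (t + j) P)"

definition Lop :: "nat \<Rightarrow> nat \<Rightarrow> nat \<Rightarrow> cpoly \<Rightarrow> cpoly" where
  "Lop m s t P = (\<Sum>j<m. pderiv_v (s + j) (pderiv_v (t + j) P))"

definition quad :: "nat \<Rightarrow> nat \<Rightarrow> nat \<Rightarrow> cpoly" where
  "quad m s t = (\<Sum>j<m. var (s + j) * var (t + j))"

lemma quad_commute: "quad m s t = quad m t s"
  by (simp add: quad_def mult.commute)

lemma Lop_commute: "Lop m s t P = Lop m t s P"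
  by (simp add: Lop_def pderiv_v_commute)

lemma Eop_add: "Eop m s t (P + Q) = Eop m s t P + Eop m s t Q"
  by (simp add: Eop_def pderiv_v_add algebra_simps sum.distrib)

lemma Lop_add: "Lop m s t (P + Q) = Lop m s t P + Lop m s t Q"
  by (simp add: Lop_def pderiv_v_add algebra_simps sum.distrib)

lemma Eop_diff: "Eop m s t (P - Q) = Eop m s t P - Eop m s t Q"
  by (simp add: Eop_def pderiv_v_diff algebra_simps sum_subtractf)

lemma Lop_diff: "Lop m s t (P - Q) = Lop m s t P - Lop m s t Q"
  by (simp add: Lop_def pderiv_v_diff algebra_simps sum_subtractf)

lemma Eop_scal: "Eop m s t (scal r * P) = scal r * Eop m s t P"
  by (simp add: Eop_def pderiv_v_scal_mult sum_distrib_left mult.left_commute)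

lemma Lop_scal: "Lop m s t (scal r * P) = scal r * Lop m s t P"
  by (simp add: Lop_def pderiv_v_scal_mult sum_distrib_left)

lemma Eop_0 [simp]: "Eop m s t 0 = 0"
  by (simp add: Eop_def)

lemma Lop_0 [simp]: "Lop m s t 0 = 0"
  by (simp add: Lop_def)

lemma Eop_sum: "Eop m s t (\<Sum>i\<in>I. f i) = (\<Sum>i\<in>I. Eop m s t (f i))"
  by (induction I rule: infinite_finite_induct) (auto simp: Eop_add)

text \<open>Two offsets from this set give equal or disjoint blocks of variables, so index
  contractions reduce to tests such as \<open>s = t\<close>.\<close>

definition blocks :: "nat \<Rightarrow> nat set" where "blocks m = {0, m}"

lemma blocks_simps [simp]: "0 \<in> blocks m" "m \<in> blocks m"
  by (simp_all add: blocks_def)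

lemma block_index_eq:
  assumes "s \<in> blocks m" "t \<in> blocks m" "i < m" "j < m"
  shows "s + i = t + j \<longleftrightarrow> s = t \<and> i = j"
  using assms by (auto simp: blocks_def; linarith)

lemma sum_block_delta:
  fixes f :: "nat \<Rightarrow> cpoly"
  assumes "s \<in> blocks m" "a \<in> blocks m" "i < m"
  shows "(\<Sum>j<m. (if s + i = a + j then f j else 0)) = (if s = a then f i else 0)"
proof -
  have "(\<Sum>j<m. (if s + i = a + j then f j else 0))
      = (\<Sum>j<m. (if i = j then (if s = a then f j else 0) else 0))"
    using assms by (intro sum.cong refl) (auto simp: block_index_eq[of _ m])
  then show ?thesis using assms by simp
qed

section \<open>Commutators of the Laplace, Euler and multiplication operators\<close>

lemma pderiv_v_Eop:
  assumes "s \<in> blocks m" "a \<in> blocks m" "i < m"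
  shows "pderiv_v (s + i) (Eop m a b P)
    = (if s = a then pderiv_v (b + i) P else 0) + Eop m a b (pderiv_v (s + i) P)"
proof -
  have "pderiv_v (s + i) (Eop m a b P)
      = (\<Sum>j<m. (if s + i = a + j then pderiv_v (b + j) P else 0))
        + (\<Sum>j<m. var (a + j) * pderiv_v (s + i) (pderiv_v (b + j) P))"
    by (simp add: Eop_def pderiv_v_sum pderiv_v_var_mult sum.distrib)
  also have "(\<Sum>j<m. (if s + i = a + j then pderiv_v (b + j) P else 0))
      = (if s = a then pderiv_v (b + i) P else 0)"
    by (rule sum_block_delta[OF assms])
  finally show ?thesis
    by (simp add: Eop_def pderiv_v_commute[of "s + i"])
qed

lemma pderiv_v_quad:
  assumes "s \<in> blocks m" "a \<in> blocks m" "b \<in> blocks m" "i < m"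
  shows "pderiv_v (s + i) (quad m a b * P)
    = (if s = a then var (b + i) * P else 0) + (if s = b then var (a + i) * P else 0)
      + quad m a b * pderiv_v (s + i) P"
proof -
  have "pderiv_v (s + i) (quad m a b * P)
      = (\<Sum>j<m. (if s + i = a + j then var (b + j) * P else 0))
        + (\<Sum>j<m. (if s + i = b + j then var (a + j) * P else 0))
        + (\<Sum>j<m. var (a + j) * (var (b + j) * pderiv_v (s + i) P))"
    unfolding quad_def sum_distrib_right pderiv_v_sum mult.assoc pderiv_v_var_mult
      distrib_left sum.distrib
    by (auto simp: add_ac intro!: sum.cong)
  also have "(\<Sum>j<m. (if s + i = a + j then var (b + j) * P else 0))
      = (if s = a then var (b + i) * P else 0)"
    by (rule sum_block_delta[OF assms(1,2,4)])
  also have "(\<Sum>j<m. (if s + i = b + j then var (a + j) * P else 0))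
      = (if s = b then var (a + i) * P else 0)"
    by (rule sum_block_delta[OF assms(1,3,4)])
  finally show ?thesis
    by (simp add: quad_def sum_distrib_right mult.assoc)
qed

lemma Eop_var_mult:
  assumes "s \<in> blocks m" "b \<in> blocks m" "i < m"
  shows "Eop m a b (var (s + i) * P)
    = (if b = s then var (a + i) * P else 0) + var (s + i) * Eop m a b P"
proof -
  have "Eop m a b (var (s + i) * P)
      = (\<Sum>j<m. (if b + j = s + i then var (a + j) * P else 0))
        + (\<Sum>j<m. var (s + i) * (var (a + j) * pderiv_v (b + j) P))"
    unfolding Eop_def pderiv_v_var_mult distrib_left sum.distrib
    by (auto simp: mult.left_commute intro!: sum.cong arg_cong2[of _ _ _ _ "(+)"])
  also have "(\<Sum>j<m. (if b + j = s + i then var (a + j) * P else 0))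
      = (if b = s then var (a + i) * P else 0)"
    using sum_block_delta[of s m b i "\<lambda>j. var (a + j) * P"] assms
    by (simp add: eq_commute[of _ "s + i"] eq_commute[of b s])
  finally show ?thesis
    by (simp add: Eop_def sum_distrib_left)
qed

lemma Eop_quad:
  assumes "t \<in> blocks m" "a \<in> blocks m" "b \<in> blocks m"
  shows "Eop m s t (quad m a b * P) = quad m a b * Eop m s t P
    + (if t = a then quad m s b * P else 0) + (if t = b then quad m s a * P else 0)"
proof -
  have "Eop m s t (quad m a b * P) = (\<Sum>i<m. var (s + i) *
      ((if t = a then var (b + i) * P else 0) + (if t = b then var (a + i) * P else 0)
      + quad m a b * pderiv_v (t + i) P))"
    unfolding Eop_def using assms by (intro sum.cong refl) (simp add: pderiv_v_quad)
  then show ?thesis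
    by (auto simp: Eop_def quad_def[of m s] sum_distrib_left sum_distrib_right sum.distrib algebra_simps)
qed

lemma divergence_var:
  assumes "s \<in> blocks m" "b \<in> blocks m"
  shows "(\<Sum>i<m. pderiv_v (s + i) (var (b + i) * P))
    = (if s = b then of_nat m * P else 0) + Eop m b s P"
proof -
  have "(\<Sum>i<m. pderiv_v (s + i) (var (b + i) * P))
      = (\<Sum>i<m. (if s = b then P else 0) + var (b + i) * pderiv_v (s + i) P)"
    using assms by (simp add: pderiv_v_var_mult block_index_eq[of _ m])
  then show ?thesis
    by (simp add: Eop_def sum.distrib)
qed

text \<open>For \<open>s = t = a = b\<close> the extra terms add up to 4 E + 2 m with the Euler
  operator E. This sl(2) relation is the source of the denominators in the closed forms.\<close>

lemma Lop_quad:
  assumes "s \<in> blocks m" "t \<in> blocks m" "a \<in> blocks m" "b \<in> blocks m"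
  shows "Lop m s t (quad m a b * P) = quad m a b * Lop m s t P
    + (if s = a then Eop m b t P else 0) + (if s = b then Eop m a t P else 0)
    + (if t = a then Eop m b s P else 0) + (if t = b then Eop m a s P else 0)
    + (if s = b \<and> t = a then of_nat m * P else 0) + (if s = a \<and> t = b then of_nat m * P else 0)"
proof -
  have "Lop m s t (quad m a b * P) = (\<Sum>i<m. pderiv_v (s + i)
      ((if t = a then var (b + i) * P else 0) + (if t = b then var (a + i) * P else 0)
      + quad m a b * pderiv_v (t + i) P))"
    unfolding Lop_def using assms by (intro sum.cong refl) (simp add: pderiv_v_quad)
  also have "\<dots> = (if t = a then (\<Sum>i<m. pderiv_v (s + i) (var (b + i) * P)) else 0)
      + (if t = b then (\<Sum>i<m. pderiv_v (s + i) (var (a + i) * P)) else 0)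
      + (\<Sum>i<m. pderiv_v (s + i) (quad m a b * pderiv_v (t + i) P))"
    by (simp add: pderiv_v_add sum.distrib)
  also have "(\<Sum>i<m. pderiv_v (s + i) (quad m a b * pderiv_v (t + i) P))
      = (if s = a then Eop m b t P else 0) + (if s = b then Eop m a t P else 0)
      + quad m a b * Lop m s t P"
  proof -
    have "(\<Sum>i<m. pderiv_v (s + i) (quad m a b * pderiv_v (t + i) P))
        = (\<Sum>i<m. (if s = a then var (b + i) * pderiv_v (t + i) P else 0)
          + (if s = b then var (a + i) * pderiv_v (t + i) P else 0)
          + quad m a b * pderiv_v (s + i) (pderiv_v (t + i) P))"
      using assms by (intro sum.cong refl) (simp add: pderiv_v_quad)
    then show ?thesis by (simp add: Eop_def Lop_def sum.distrib sum_distrib_left)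
  qed
  finally show ?thesis
    using assms by (auto simp: divergence_var)
qed

lemma Lop_Eop:
  assumes "s \<in> blocks m" "t \<in> blocks m" "a \<in> blocks m" "b \<in> blocks m"
  shows "Lop m s t (Eop m a b P) = Eop m a b (Lop m s t P)
    + (if t = a then Lop m s b P else 0) + (if s = a then Lop m b t P else 0)"
proof -
  have "Lop m s t (Eop m a b P) = (\<Sum>i<m. pderiv_v (s + i)
      ((if t = a then pderiv_v (b + i) P else 0) + Eop m a b (pderiv_v (t + i) P)))"
    unfolding Lop_def using assms by (intro sum.cong refl) (simp add: pderiv_v_Eop)
  also have "\<dots> = (if t = a then Lop m s b P else 0)
      + (\<Sum>i<m. pderiv_v (s + i) (Eop m a b (pderiv_v (t + i) P)))"
    by (simp add: pderiv_v_add sum.distrib Lop_def)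
  also have "(\<Sum>i<m. pderiv_v (s + i) (Eop m a b (pderiv_v (t + i) P)))
      = (if s = a then Lop m b t P else 0) + Eop m a b (Lop m s t P)"
  proof -
    have "(\<Sum>i<m. pderiv_v (s + i) (Eop m a b (pderiv_v (t + i) P)))
        = (\<Sum>i<m. (if s = a then pderiv_v (b + i) (pderiv_v (t + i) P) else 0)
          + Eop m a b (pderiv_v (s + i) (pderiv_v (t + i) P)))"
      using assms by (intro sum.cong refl) (simp add: pderiv_v_Eop)
    then show ?thesis by (simp add: sum.distrib Lop_def Eop_sum)
  qed
  finally show ?thesis by simp
qed

lemma Eop_Eop:
  assumes "s \<in> blocks m" "t \<in> blocks m" "a \<in> blocks m" "b \<in> blocks m"
  shows "Eop m s t (Eop m a b P) = Eop m a b (Eop m s t P)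
    + (if t = a then Eop m s b P else 0) - (if b = s then Eop m a t P else 0)"
proof -
  have "Eop m s t (Eop m a b P) = (\<Sum>i<m. var (s + i) *
      ((if t = a then pderiv_v (b + i) P else 0) + Eop m a b (pderiv_v (t + i) P)))"
    unfolding Eop_def[of m s t] using assms by (intro sum.cong refl) (simp add: pderiv_v_Eop)
  also have "\<dots> = (if t = a then Eop m s b P else 0)
      + (\<Sum>i<m. var (s + i) * Eop m a b (pderiv_v (t + i) P))"
    by (simp add: distrib_left sum.distrib Eop_def[of m s b])
  moreover have "Eop m a b (Eop m s t P) = (if b = s then Eop m a t P else 0)
      + (\<Sum>i<m. var (s + i) * Eop m a b (pderiv_v (t + i) P))"
  proof -
    have "Eop m a b (Eop m s t P)
        = (\<Sum>i<m. (if b = s then var (a + i) * pderiv_v (t + i) P else 0)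
          + var (s + i) * Eop m a b (pderiv_v (t + i) P))"
      unfolding Eop_def[of m s t] Eop_sum
      using assms by (intro sum.cong refl) (simp add: Eop_var_mult)
    then show ?thesis by (simp add: sum.distrib Eop_def[of m a t])
  qed
  ultimately show ?thesis by simp
qed

lemma Lop_Lop: "Lop m s t (Lop m a b P) = Lop m a b (Lop m s t P)"
proof -
  have "Lop m s t (Lop m a b P) = (\<Sum>i<m. \<Sum>j<m. pderiv_v (a + j) (pderiv_v (b + j) (pderiv_v (s + i) (pderiv_v (t + i) P))))"
    unfolding Lop_def pderiv_v_sum
    by (intro sum.cong refl) (metis pderiv_v_commute)
  also have "\<dots> = Lop m a b (Lop m s t P)"
    unfolding Lop_def pderiv_v_sum by (rule sum.swap)
  finally show ?thesis .
qed

lemma fischer_quad: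
  assumes "s \<in> blocks m"
  shows "fischer m (quad m s s * P) Q = fischer m P (Lop m s s Q)"
proof -
  have "fischer m (quad m s s * P) Q
      = (\<Sum>j<m. fischer m (var (s + j) * (var (s + j) * P)) Q)"
    by (simp add: quad_def sum_distrib_right fischer_sum_left mult.assoc)
  also have "\<dots> = (\<Sum>j<m. fischer m P (pderiv_v (s + j) (pderiv_v (s + j) Q)))"
    using assms by (intro sum.cong refl) (auto simp: fischer_adjoint blocks_def)
  finally show ?thesis by (simp add: Lop_def fischer_sum_right)
qed

text \<open>A harmonic polynomial is Fischer-orthogonal to the ideal, so one that lies in the ideal
  is orthogonal to itself.\<close>

lemma harmonic_in_ideal_zero:
  assumes "Lop m 0 0 P = 0" "Lop m m m P = 0"
    and "P = quad m 0 0 * A + quad m m m * B"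
  shows "P = 0"
proof (rule fischer_definite)
  have "fischer m P P = fischer m (quad m 0 0 * A + quad m m m * B) P"
    using assms(3) by simp
  also have "\<dots> = 0"
    using assms(1,2) by (simp add: fischer_add_left fischer_quad)
  finally show "fischer m P P = 0" .
qed

section \<open>Bidegrees and the harmonic projection\<close>

lemma lookup_Eop_diag:
  "Poly_Mapping.lookup (Eop m s s P) mon
    = of_nat (\<Sum>j<m. Poly_Mapping.lookup mon (s + j)) * Poly_Mapping.lookup P mon"
  by (simp add: Eop_def lookup_sum lookup_var_pderiv_v sum_distrib_right)

lemma Eop_diag_eq_iff:
  "Eop m s s P = scal r * P \<longleftrightarrow>
    (\<forall>mon\<in>Poly_Mapping.keys P. real (\<Sum>j<m. Poly_Mapping.lookup mon (s + j)) = r)"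
proof -
  have "Eop m s s P = scal r * P \<longleftrightarrow>
    (\<forall>mon. complex_of_real (real (\<Sum>j<m. Poly_Mapping.lookup mon (s + j))) * Poly_Mapping.lookup P mon
       = complex_of_real r * Poly_Mapping.lookup P mon)"
    unfolding poly_mapping_eq_iff fun_eq_iff lookup_Eop_diag lookup_scal_mult
    by (simp only: of_real_of_nat_eq)
  then show ?thesis
    by (auto simp only: mult_cancel_right of_real_eq_iff in_keys_iff)
qed

text \<open>Absence of a variable becomes a differential equation, so that a bidegree is described
  by linear operator equations alone and can be followed through commutators.\<close>

lemma keys_vars_iff:
  "(\<forall>mon\<in>Poly_Mapping.keys P. Poly_Mapping.lookup mon v = 0) \<longleftrightarrow> pderiv_v v P = 0"
proof
  assume L: "\<forall>mon\<in>Poly_Mapping.keys P. Poly_Mapping.lookup mon v = 0"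
  show "pderiv_v v P = 0"
  proof (intro poly_mapping_eqI)
    fix mon
    have "mon + ev v \<notin> Poly_Mapping.keys P"
    proof
      assume "mon + ev v \<in> Poly_Mapping.keys P"
      from bspec[OF L this] show False by (simp add: lookup_add)
    qed
    then show "Poly_Mapping.lookup (pderiv_v v P) mon = Poly_Mapping.lookup 0 mon"
      by (simp add: lookup_pderiv_v in_keys_iff)
  qed
next
  assume "pderiv_v v P = 0"
  then show "\<forall>mon\<in>Poly_Mapping.keys P. Poly_Mapping.lookup mon v = 0"
    using lookup_var_pderiv_v[of v P] by (auto simp: in_keys_iff)
qed

text \<open>Degrees are real numbers here, which avoids truncated subtraction: a nonzero polynomial of
  bidegree \<open>(r, q)\<close> has natural \<open>r\<close> and \<open>q\<close>, and zero has every bidegree.\<close>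

definition bideg :: "nat \<Rightarrow> nat \<Rightarrow> nat \<Rightarrow> real \<Rightarrow> real \<Rightarrow> cpoly \<Rightarrow> bool" where
  "bideg m s t r q P \<longleftrightarrow> (\<forall>v\<ge>2 * m. pderiv_v v P = 0)
      \<and> Eop m s s P = scal r * P \<and> Eop m t t P = scal q * P"

definition harm :: "nat \<Rightarrow> nat \<Rightarrow> nat \<Rightarrow> real \<Rightarrow> real \<Rightarrow> cpoly \<Rightarrow> bool" where
  "harm m s t r q P \<longleftrightarrow> bideg m s t r q P \<and> Lop m s s P = 0 \<and> Lop m t t P = 0"

lemma bihom_iff_bideg: "bihom m p q P \<longleftrightarrow> bideg m 0 m (real p) (real q) P"
  unfolding bihom_def bideg_def Eop_diag_eq_iff keys_vars_iff[symmetric] of_nat_eq_iff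
  by (auto simp del: of_nat_sum)

lemma bideg_nat:
  assumes "bideg m s t r q P" "P \<noteq> 0"
  shows "r \<in> \<nat>" "q \<in> \<nat>"
proof -
  obtain mon where "mon \<in> Poly_Mapping.keys P"
    using assms(2) keys_eq_empty by blast
  then show "r \<in> \<nat>" "q \<in> \<nat>"
    using assms(1) unfolding bideg_def Eop_diag_eq_iff by (metis of_nat_in_Nats)+
qed

lemma operator_eqs:
  "Lap_x m = Lop m 0 0" "Lap_u m = Lop m m m" "du_dx m = Lop m 0 m"
  "x_du m = Eop m 0 m" "u_dx m = Eop m m 0"
  "xsq m = quad m 0 0" "usq m = quad m m m" "ux m = quad m 0 m"
  by (auto simp: fun_eq_iff Lap_x_def Lap_u_def du_dx_def x_du_def u_dx_def xsq_def usq_def ux_def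
      dx_def du_def Xv_def Uv_def Lop_def Eop_def quad_def power2_eq_square mult.commute pderiv_v_commute
      intro!: sum.cong)

lemma harm2_iff_harm: "harm2 m p q P \<longleftrightarrow> harm m 0 m (real p) (real q) P"
  by (simp add: harm2_def harm_def bihom_iff_bideg operator_eqs)

lemma harm_zero [simp]: "harm m s t r q 0"
  by (simp add: harm_def bideg_def)

lemma harm_eq_zero:
  assumes "harm m s t r q P" "r \<notin> \<nat> \<or> q \<notin> \<nat>"
  shows "P = 0"
  using bideg_nat assms unfolding harm_def by blast

text \<open>Lowering operators formally produce negative degrees. The polynomial vanishes there, so
  later statements need no separate case for exhausted degrees.\<close>

lemma harm_neg:
  assumes "harm m s t r q P" "r < 0 \<or> q < 0"
  shows "P = 0"
  using assms by (auto intro!: harm_eq_zero elim!: Nats_cases)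

lemma harm_swap: "harm m s t r q P \<longleftrightarrow> harm m t s q r P"
  by (auto simp: harm_def bideg_def)

lemma harm_add: "harm m s t r q P \<Longrightarrow> harm m s t r q Q \<Longrightarrow> harm m s t r q (P + Q)"
  by (simp add: harm_def bideg_def pderiv_v_add Eop_add Lop_add algebra_simps)

lemma harm_scal: "harm m s t r q P \<Longrightarrow> harm m s t r q (scal c * P)"
  by (simp add: harm_def bideg_def pderiv_v_scal_mult Eop_scal Lop_scal mult.left_commute)

section \<open>Uniqueness and evaluation of the harmonic projection\<close>

lemma pi_s_unique:
  assumes "P = H + quad m 0 0 * A + quad m m m * B" "P = H' + quad m 0 0 * A' + quad m m m * B'"
    and "Lop m 0 0 H = 0" "Lop m m m H = 0" "Lop m 0 0 H' = 0" "Lop m m m H' = 0"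
  shows "H = H'"
proof -
  have "H - H' = quad m 0 0 * (A' - A) + quad m m m * (B' - B)"
    using assms(1,2) by (simp add: algebra_simps)
  then have "H - H' = 0"
    by (rule harmonic_in_ideal_zero[rotated 2]) (simp_all add: Lop_diff assms(3-))
  then show ?thesis by simp
qed

lemma double_sum_mod_ideal:
  fixes G :: "nat \<Rightarrow> nat \<Rightarrow> cpoly"
  shows "\<exists>A B. (\<Sum>a\<le>N. \<Sum>b\<le>M. X ^ a * Y ^ b * G a b) = G 0 0 + X * A + Y * B"
proof -
  have "(\<Sum>a\<le>N. \<Sum>b\<le>M. X ^ a * Y ^ b * G a b)
     = (\<Sum>b\<le>M. Y ^ b * G 0 b) + X * (\<Sum>a<N. \<Sum>b\<le>M. X ^ a * Y ^ b * G (Suc a) b)"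
    by (simp add: sum.atMost_shift[of _ N] sum_distrib_left mult_ac)
  moreover have "(\<Sum>b\<le>M. Y ^ b * G 0 b) = G 0 0 + Y * (\<Sum>b<M. Y ^ b * G 0 (Suc b))"
    by (simp add: sum.atMost_shift sum_distrib_left mult_ac)
  ultimately have "(\<Sum>a\<le>N. \<Sum>b\<le>M. X ^ a * Y ^ b * G a b)
     = G 0 0 + X * (\<Sum>a<N. \<Sum>b\<le>M. X ^ a * Y ^ b * G (Suc a) b) + Y * (\<Sum>b<M. Y ^ b * G 0 (Suc b))"
    by (simp only: add_ac)
  then show ?thesis by blast
qed

text \<open>The description in \<open>pi_s\<close> is well defined although \<open>P = 0\<close>
  fits every bidegree: the leading terms of two decompositions agree modulo the ideal even if their
  degrees differ, and \<open>pi_s_unique\<close> asks for no more.\<close>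

lemma pi_s_eqI_nat:
  assumes "bihom m p q P"
    and "\<And>a b. a \<le> p div 2 \<Longrightarrow> b \<le> q div 2 \<Longrightarrow> harm2 m (p - 2*a) (q - 2*b) (G a b)"
    and "P = (\<Sum>a\<le>p div 2. \<Sum>b\<le>q div 2. quad m 0 0 ^ a * quad m m m ^ b * G a b)"
  shows "pi_s m P = G 0 0"
  unfolding pi_s_def operator_eqs
proof (rule the_equality, intro exI conjI)
  show "bihom m p q P" by fact
  show "\<forall>a\<le>p div 2. \<forall>b\<le>q div 2. harm2 m (p - 2*a) (q - 2*b) (G a b)" using assms(2) by blast
  show "P = (\<Sum>a\<le>p div 2. \<Sum>b\<le>q div 2. quad m 0 0 ^ a * quad m m m ^ b * G a b)" by fact
  show "G 0 0 = G 0 0" by (rule refl)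
next
  fix H
  assume "\<exists>p q G. bihom m p q P \<and> (\<forall>a\<le>p div 2. \<forall>b\<le>q div 2. harm2 m (p - 2*a) (q - 2*b) (G a b))
    \<and> P = (\<Sum>a\<le>p div 2. \<Sum>b\<le>q div 2. quad m 0 0 ^ a * quad m m m ^ b * G a b) \<and> H = G 0 0"
  then obtain p' q' G' where *: "\<forall>a\<le>p' div 2. \<forall>b\<le>q' div 2. harm2 m (p' - 2*a) (q' - 2*b) (G' a b)"
    "P = (\<Sum>a\<le>p' div 2. \<Sum>b\<le>q' div 2. quad m 0 0 ^ a * quad m m m ^ b * G' a b)" "H = G' 0 0"
    by blast
  obtain A B where AB: "P = G' 0 0 + quad m 0 0 * A + quad m m m * B"
    using double_sum_mod_ideal[of "quad m 0 0" "quad m m m" G' "q' div 2" "p' div 2"]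
    unfolding *(2)[symmetric] by blast
  obtain A' B' where AB': "P = G 0 0 + quad m 0 0 * A' + quad m m m * B'"
    using double_sum_mod_ideal[of "quad m 0 0" "quad m m m" G "q div 2" "p div 2"]
    unfolding assms(3)[symmetric] by blast
  have "harm2 m (p - 2*0) (q - 2*0) (G 0 0)" "harm2 m (p' - 2*0) (q' - 2*0) (G' 0 0)"
    using assms(2) *(1) by blast+
  then show "H = G 0 0"
    unfolding *(3) by (intro pi_s_unique[OF AB AB']) (auto simp: harm2_iff_harm harm_def)
qed

text \<open>Four components suffice because each projected operator produces at most one factor
  |x|^2 and one factor |u|^2.\<close>

lemma pi_s_eqI:
  assumes P: "P = H + quad m 0 0 * G1 + quad m m m * G2 + quad m 0 0 * (quad m m m * G3)"
    and "bideg m 0 m r q P" and "harm m 0 m r q H" and "harm m 0 m (r - 2) q G1"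
    and "harm m 0 m r (q - 2) G2" and "harm m 0 m (r - 2) (q - 2) G3"
  shows "pi_s m P = H"
proof (cases "r \<in> \<nat> \<and> q \<in> \<nat>")
  case True
  then obtain p' q' where pq: "r = real p'" "q = real q'" by (auto elim!: Nats_cases)
  define G where "G = (\<lambda>(a::nat) (b::nat). if a = 0 \<and> b = 0 then H else if a = 1 \<and> b = 0 then G1
    else if a = 0 \<and> b = 1 then G2 else if a = 1 \<and> b = 1 then G3 else 0)"
  \<comment> \<open>If a degree is below 2, the sum does not reach index 1; the components it would
    miss have a negative degree and are zero.\<close>
  have small: "p' div 2 = 0 \<Longrightarrow> G1 = 0 \<and> G3 = 0" "q' div 2 = 0 \<Longrightarrow> G2 = 0 \<and> G3 = 0"
    using harm_neg[OF assms(4)] harm_neg[OF assms(5)] harm_neg[OF assms(6)] pq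
    by (auto simp: div_eq_0_iff)
  have "harm2 m (p' - 2*a) (q' - 2*b) (G a b)" if ab: "a \<le> p' div 2" "b \<le> q' div 2" for a b
  proof -
    have "real (p' - 2*a) = r - 2 * real a" "real (q' - 2*b) = q - 2 * real b"
      using ab pq by auto
    then show ?thesis using assms(3-) by (auto simp: harm2_iff_harm G_def)
  qed
  moreover have inner: "(\<Sum>b\<le>q' div 2. Y ^ b * G a b) = G a 0 + Y * G a 1" for Y :: cpoly and a
  proof -
    have "(\<Sum>b\<le>q' div 2. Y ^ b * G a b) = (\<Sum>b\<in>{0,1}. Y ^ b * G a b)"
      using small by (intro sum.mono_neutral_cong) (auto simp: G_def not_le)
    then show ?thesis by simp
  qed
  have "P = (\<Sum>a\<le>p' div 2. \<Sum>b\<le>q' div 2. quad m 0 0 ^ a * quad m m m ^ b * G a b)"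
  proof -
    have "(\<Sum>a\<le>p' div 2. \<Sum>b\<le>q' div 2. quad m 0 0 ^ a * quad m m m ^ b * G a b)
      = (\<Sum>a\<le>p' div 2. quad m 0 0 ^ a * (G a 0 + quad m m m * G a 1))"
      by (simp add: mult.assoc sum_distrib_left[symmetric] inner)
    also have "\<dots> = (\<Sum>a\<in>{0,1}. quad m 0 0 ^ a * (G a 0 + quad m m m * G a 1))"
      using small by (intro sum.mono_neutral_cong) (auto simp: G_def not_le)
    finally show ?thesis unfolding P by (simp add: G_def algebra_simps)
  qed
  ultimately have "pi_s m P = G 0 0"
    using assms(2) pq by (intro pi_s_eqI_nat[of m p' q']) (auto simp: bihom_iff_bideg)
  then show ?thesis by (simp add: G_def)
next
  case False
  \<comment> \<open>Such degrees arise when a lowering operator acts in degree 0. All components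
    vanish, and \<open>pi_s\<close> is evaluated at the zero polynomial in bidegree (0, 0).\<close>
  have "r - 2 \<in> \<nat> \<Longrightarrow> r \<in> \<nat>" for r :: real
    using Nats_add[of "r - 2" "2"] by simp
  then have z: "H = 0" "G1 = 0" "G2 = 0" "G3 = 0"
    using False assms(3-) harm_eq_zero by blast+
  then have "P = 0" using P by simp
  then have "pi_s m P = (\<lambda>_ _. 0) (0::nat) (0::nat)"
    by (intro pi_s_eqI_nat[of m 0 0]) (auto simp: bihom_iff_bideg harm2_iff_harm bideg_def)
  then show ?thesis using z by simp
qed

section \<open>The quadratic relations between the projected operators\<close>

text \<open>Closed forms of the projected operators on harmonic polynomials of bidegree \<open>(r, q)\<close>: for
  \<open>(s, t) = (0, m)\<close> the first is \<open>S_x\<close>, for \<open>(s, t) = (m, 0)\<close> (with \<open>q\<close> in place of \<open>r\<close>) it is \<open>S_u\<close>, and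
  the second is \<open>C_op\<close>.\<close>

definition raise_op :: "nat \<Rightarrow> nat \<Rightarrow> nat \<Rightarrow> real \<Rightarrow> cpoly \<Rightarrow> cpoly" where
  "raise_op m s t r P = Eop m s t P - scal (1 / (2 * r + real m - 2)) * (quad m s s * Lop m s t P)"

definition cup_op :: "nat \<Rightarrow> nat \<Rightarrow> nat \<Rightarrow> real \<Rightarrow> real \<Rightarrow> cpoly \<Rightarrow> cpoly" where
  "cup_op m s t r q P = quad m s t * P
     - scal (1 / (2 * r + real m - 2)) * (quad m s s * Eop m t s P)
     - scal (1 / (2 * q + real m - 2)) * (quad m t t * Eop m s t P)
     + scal (1 / (2 * r + real m - 2)) * (scal (1 / (2 * q + real m - 2))
         * (quad m s s * (quad m t t * Lop m s t P)))"

lemma cup_op_swap: "cup_op m s t r q P = cup_op m t s q r P"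
  by (simp add: cup_op_def quad_commute[of m s t] Lop_commute[of m s t] algebra_simps)

locale block_pair =
  fixes m s t :: nat
  assumes m: "m > 4" and st: "s = 0 \<and> t = m \<or> s = m \<and> t = 0"
begin

lemma blocks_st [simp]: "s \<in> blocks m" "t \<in> blocks m" "s \<noteq> t" "t \<noteq> s"
  using m st by auto

lemma Lop_ss_quad:
  "Lop m s s (quad m s s * P) = quad m s s * Lop m s s P + 4 * Eop m s s P + 2 * of_nat m * P"
  "Lop m s s (quad m t t * P) = quad m t t * Lop m s s P"
  "Lop m s s (quad m s t * P) = quad m s t * Lop m s s P + 2 * Eop m t s P"
  by (simp_all add: Lop_quad)

lemma Lop_tt_quad:
  "Lop m t t (quad m t t * P) = quad m t t * Lop m t t P + 4 * Eop m t t P + 2 * of_nat m * P"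
  "Lop m t t (quad m s s * P) = quad m s s * Lop m t t P"
  "Lop m t t (quad m s t * P) = quad m s t * Lop m t t P + 2 * Eop m s t P"
  by (simp_all add: Lop_quad)

lemma Lop_st_quad:
  "Lop m s t (quad m s s * P) = quad m s s * Lop m s t P + 2 * Eop m s t P"
  "Lop m s t (quad m t t * P) = quad m t t * Lop m s t P + 2 * Eop m t s P"
  "Lop m s t (quad m s t * P) = quad m s t * Lop m s t P + Eop m s s P + Eop m t t P + of_nat m * P"
  by (simp_all add: Lop_quad)

lemma Lop_off:
  "Lop m s s (Eop m s t P) = Eop m s t (Lop m s s P) + 2 * Lop m s t P"
  "Lop m s s (Eop m t s P) = Eop m t s (Lop m s s P)"
  "Lop m t t (Eop m s t P) = Eop m s t (Lop m t t P)"
  "Lop m t t (Eop m t s P) = Eop m t s (Lop m t t P) + 2 * Lop m s t P"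
  "Lop m s t (Eop m s t P) = Eop m s t (Lop m s t P) + Lop m t t P"
  "Lop m s t (Eop m t s P) = Eop m t s (Lop m s t P) + Lop m s s P"
  by (simp_all add: Lop_Eop Lop_commute[of m t s])

lemma Eop_off_quad:
  "Eop m s t (quad m s s * P) = quad m s s * Eop m s t P"
  "Eop m s t (quad m t t * P) = quad m t t * Eop m s t P + 2 * quad m s t * P"
  "Eop m s t (quad m s t * P) = quad m s t * Eop m s t P + quad m s s * P"
  "Eop m t s (quad m t t * P) = quad m t t * Eop m t s P"
  "Eop m t s (quad m s s * P) = quad m s s * Eop m t s P + 2 * quad m s t * P"
  "Eop m t s (quad m s t * P) = quad m s t * Eop m t s P + quad m t t * P"
  by (simp_all add: Eop_quad quad_commute[of m t s])

lemma Eop_diag_quad: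
  "Eop m s s (quad m s s * P) = quad m s s * Eop m s s P + 2 * quad m s s * P"
  "Eop m s s (quad m t t * P) = quad m t t * Eop m s s P"
  "Eop m s s (quad m s t * P) = quad m s t * Eop m s s P + quad m s t * P"
  "Eop m t t (quad m s s * P) = quad m s s * Eop m t t P"
  "Eop m t t (quad m t t * P) = quad m t t * Eop m t t P + 2 * quad m t t * P"
  "Eop m t t (quad m s t * P) = quad m s t * Eop m t t P + quad m s t * P"
  by (simp_all add: Eop_quad quad_commute[of m t s])

lemma Eop_commutator: "Eop m s t (Eop m t s P) = Eop m t s (Eop m s t P) + Eop m s s P - Eop m t t P"
  by (simp add: Eop_Eop[of s m t t s])

lemma Eop_diag_off:
  "Eop m s s (Eop m s t P) = Eop m s t (Eop m s s P) + Eop m s t P"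
  "Eop m s s (Eop m t s P) = Eop m t s (Eop m s s P) - Eop m t s P"
  "Eop m t t (Eop m s t P) = Eop m s t (Eop m t t P) - Eop m s t P"
  "Eop m t t (Eop m t s P) = Eop m t s (Eop m t t P) + Eop m t s P"
  by (simp_all add: Eop_Eop[of s m s] Eop_Eop[of t m t])

lemma Eop_diag_Lop:
  "Eop m s s (Lop m s t P) = Lop m s t (Eop m s s P) - Lop m s t P"
  "Eop m t t (Lop m s t P) = Lop m s t (Eop m t t P) - Lop m s t P"
  by (simp_all add: Lop_Eop Lop_commute[of m t s])

section \<open>Bidegree and harmonicity of the closed forms\<close>

lemma pderiv_v_outside:
  assumes "v \<ge> 2 * m" "a \<in> blocks m" "b \<in> blocks m"
  shows "pderiv_v v (quad m a b * P) = quad m a b * pderiv_v v P"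
    and "pderiv_v v (Eop m a b P) = Eop m a b (pderiv_v v P)"
    and "pderiv_v v (Lop m a b P) = Lop m a b (pderiv_v v P)"
proof -
  have ne: "v \<noteq> a + j" "v \<noteq> b + j" if "j < m" for j
    using that assms by (auto simp: blocks_def)
  show "pderiv_v v (quad m a b * P) = quad m a b * pderiv_v v P"
    unfolding quad_def sum_distrib_right pderiv_v_sum
    by (intro sum.cong refl) (simp add: mult.assoc pderiv_v_var_mult ne)
  show "pderiv_v v (Eop m a b P) = Eop m a b (pderiv_v v P)"
    unfolding Eop_def pderiv_v_sum
    by (intro sum.cong refl) (simp add: pderiv_v_var_mult ne pderiv_v_commute[of v])
  show "pderiv_v v (Lop m a b P) = Lop m a b (pderiv_v v P)"
    by (simp add: Lop_def pderiv_v_sum pderiv_v_commute[of v])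
qed

lemma bideg_diff:
  "bideg m s t r q P \<Longrightarrow> bideg m s t r q Q \<Longrightarrow> bideg m s t r q (P - Q)"
  by (simp add: bideg_def pderiv_v_diff Eop_diff algebra_simps)

lemma bideg_add:
  "bideg m s t r q P \<Longrightarrow> bideg m s t r q Q \<Longrightarrow> bideg m s t r q (P + Q)"
  by (simp add: bideg_def pderiv_v_add Eop_add algebra_simps)

lemma bideg_scal: "bideg m s t r q P \<Longrightarrow> bideg m s t r q (scal c * P)"
  by (simp add: bideg_def pderiv_v_scal_mult Eop_scal mult.left_commute)

lemma bideg_quad:
  "bideg m s t r q P \<Longrightarrow> r' = r + 2 \<Longrightarrow> bideg m s t r' q (quad m s s * P)"
  "bideg m s t r q P \<Longrightarrow> q' = q + 2 \<Longrightarrow> bideg m s t r q' (quad m t t * P)"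
  "bideg m s t r q P \<Longrightarrow> r' = r + 1 \<Longrightarrow> q' = q + 1 \<Longrightarrow> bideg m s t r' q' (quad m s t * P)"
  by (simp_all add: bideg_def pderiv_v_outside Eop_diag_quad scal_add scal_numeral
      distrib_left distrib_right mult.left_commute mult.assoc)

lemma bideg_Eop:
  "bideg m s t r q P \<Longrightarrow> r' = r + 1 \<Longrightarrow> q' = q - 1 \<Longrightarrow> bideg m s t r' q' (Eop m s t P)"
  "bideg m s t r q P \<Longrightarrow> r' = r - 1 \<Longrightarrow> q' = q + 1 \<Longrightarrow> bideg m s t r' q' (Eop m t s P)"
  by (simp_all add: bideg_def pderiv_v_outside Eop_diag_off Eop_scal scal_add scal_diff
      distrib_right left_diff_distrib)

lemma bideg_Lop:
  "bideg m s t r q P \<Longrightarrow> r' = r - 1 \<Longrightarrow> q' = q - 1 \<Longrightarrow> bideg m s t r' q' (Lop m s t P)"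
  by (simp add: bideg_def pderiv_v_outside Eop_diag_Lop Lop_scal scal_diff left_diff_distrib)

text \<open>An identity between harmonic polynomials is reduced to exhibiting some cofactors
  \<open>A\<close> and \<open>B\<close> of the difference; nothing has to be known about
  them.\<close>

lemma harm_eqI:
  assumes "harm m s t r q P" "harm m s t r q Q" "P - Q = quad m s s * A + quad m t t * B"
  shows "P = Q"
proof -
  have "Lop m s s (P - Q) = 0" "Lop m t t (P - Q) = 0"
    using assms(1,2) by (simp_all add: harm_def Lop_diff)
  moreover have "\<exists>A B. P - Q = quad m 0 0 * A + quad m m m * B"
    using st assms(3) by (metis add.commute)
  ultimately have "P - Q = 0"
    using st harmonic_in_ideal_zero by blast
  then show ?thesis by simp
qed

text \<open>The denominators of the closed forms can vanish only in degrees where the polynomial is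
  zero; hence the case splits on \<open>P = 0\<close>.\<close>

lemma harm_denom:
  assumes "harm m s t r q P" "P \<noteq> 0"
  shows "r \<ge> 0" "q \<ge> 0" "2 * r + real m - 2 > 0" "2 * q + real m - 2 > 0"
proof -
  show "r \<ge> 0" "q \<ge> 0" using harm_neg[OF assms(1)] assms(2) by force+
  then show "2 * r + real m - 2 > 0" "2 * q + real m - 2 > 0" using m by auto
qed

lemma harm_Lop:
  assumes "harm m s t r q P"
  shows "harm m s t (r - 1) (q - 1) (Lop m s t P)"
  using assms by (auto simp: harm_def Lop_Lop[of m _ _ s t] intro: bideg_Lop)

text \<open>Polynomials form only a ring; as an equation without division the inverse becomes usable
  by \<open>algebra\<close>.\<close>

lemma scal_inverse_relation:
  assumes "2 * r + real m - 2 \<noteq> 0"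
  shows "scal (1 / (2 * r + real m - 2)) * (2 * scal r + of_nat m - 2) = 1"
proof -
  have "2 * scal r + of_nat m - 2 = scal (2 * r + real m - 2)"
    by (simp add: scal_diff scal_add scal_mult scal_numeral scal_of_nat)
  then show ?thesis using assms by (simp add: scal_mult[symmetric])
qed

text \<open>Origin of the denominator: \<open>Lop m s s\<close> maps \<open>Eop m s t P\<close> to 2
  D with \<open>D = Lop m s t P\<close>. Since D has degree r - 1, it maps
  \<open>quad m s s * D\<close> to (4 (r - 1) + 2 m) D = 2 (2 r + m - 2) D.\<close>

lemma harm_raise:
  assumes "harm m s t r q P"
  shows "harm m s t (r + 1) (q - 1) (raise_op m s t r P)"
proof (cases "P = 0")
  case True
  then show ?thesis by (simp add: raise_op_def)
next
  case False
  define \<alpha> where "\<alpha> = scal (1 / (2 * r + real m - 2))"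
  define R where "R = scal r"
  define D where "D = Lop m s t P"
  have \<alpha>: "\<alpha> * (2 * R + of_nat m - 2) = 1"
    unfolding \<alpha>_def R_def using harm_denom[OF assms False] by (intro scal_inverse_relation) simp
  have P: "bideg m s t r q P" "Lop m s s P = 0" "Lop m t t P = 0"
    using assms by (auto simp: harm_def)
  have D: "Lop m s s D = 0" "Lop m t t D = 0" "Eop m s s D = (R - 1) * D"
    using harm_Lop[OF assms] by (auto simp: harm_def bideg_def D_def R_def scal_diff)
  have "bideg m s t (r + 1) (q - 1) (raise_op m s t r P)"
    unfolding raise_op_def
    by (intro bideg_diff bideg_scal bideg_Eop[OF P(1)] bideg_quad[OF bideg_Lop[OF P(1)]] refl) auto
  moreover have "Lop m s s (raise_op m s t r P) = 0"
  proof -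
    have "Lop m s s (raise_op m s t r P) = 2 * D - \<alpha> * (4 * ((R - 1) * D) + 2 * of_nat m * D)"
      unfolding raise_op_def \<alpha>_def D_def[symmetric]
      by (simp add: Lop_diff Lop_scal Lop_ss_quad Lop_off P D flip: D_def)
    also have "\<dots> = 0" using \<alpha> by algebra
    finally show ?thesis .
  qed
  moreover have "Lop m t t (raise_op m s t r P) = 0"
    unfolding raise_op_def D_def[symmetric]
    by (simp add: Lop_diff Lop_scal Lop_tt_quad Lop_off P D)
  ultimately show ?thesis by (simp add: harm_def)
qed

lemma harm_raise_ts:
  assumes "harm m s t r q P"
  shows "harm m s t (r - 1) (q + 1) (raise_op m t s q P)"
proof -
  interpret swap: block_pair m t s using m st by unfold_locales auto
  show ?thesis using swap.harm_raise assms harm_swap by blast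
qed

text \<open>Each of the two middle corrections restores harmonicity in one block and disturbs it in
  the other by a multiple of \<open>Lop m s t P\<close>; the last term, whose coefficient is the
  product of theirs, compensates both.\<close>

lemma harm_cup:
  assumes "harm m s t r q P"
  shows "harm m s t (r + 1) (q + 1) (cup_op m s t r q P)"
proof (cases "P = 0")
  case True
  then show ?thesis by (simp add: cup_op_def)
next
  case False
  define \<alpha> where "\<alpha> = scal (1 / (2 * r + real m - 2))"
  define \<beta> where "\<beta> = scal (1 / (2 * q + real m - 2))"
  define R where "R = scal r"
  define S where "S = scal q"
  have \<alpha>: "\<alpha> * (2 * R + of_nat m - 2) = 1" and \<beta>: "\<beta> * (2 * S + of_nat m - 2) = 1"
    unfolding \<alpha>_def R_def \<beta>_def S_def
    using harm_denom[OF assms False] by (auto intro!: scal_inverse_relation)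
  have P: "bideg m s t r q P" "Lop m s s P = 0" "Lop m t t P = 0" "Eop m s s P = R * P" "Eop m t t P = S * P"
    using assms by (auto simp: harm_def bideg_def R_def S_def)
  have D: "Lop m s s (Lop m s t P) = 0" "Lop m t t (Lop m s t P) = 0"
    "Eop m s s (Lop m s t P) = (R - 1) * Lop m s t P" "Eop m t t (Lop m s t P) = (S - 1) * Lop m s t P"
    using harm_Lop[OF assms] by (auto simp: harm_def bideg_def R_def S_def scal_diff)
  have E: "Eop m s s (Eop m t s P) = (R - 1) * Eop m t s P" "Eop m t t (Eop m s t P) = (S - 1) * Eop m s t P"
    using bideg_Eop[OF P(1) refl refl] by (auto simp: bideg_def R_def S_def scal_diff)
  have "bideg m s t (r + 1) (q + 1) (cup_op m s t r q P)"
    unfolding cup_op_def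
    by (intro bideg_diff bideg_add bideg_scal bideg_quad(3)[OF P(1)] bideg_quad(1)[OF bideg_Eop(2)[OF P(1)]]
        bideg_quad(2)[OF bideg_Eop(1)[OF P(1)]] bideg_quad(1)[OF bideg_quad(2)[OF bideg_Lop[OF P(1)]]] refl) auto
  moreover have "Lop m s s (cup_op m s t r q P) = 0"
  proof -
    have "Lop m s s (cup_op m s t r q P)
      = 2 * Eop m t s P - \<alpha> * (4 * ((R - 1) * Eop m t s P) + 2 * of_nat m * Eop m t s P)
        - \<beta> * (quad m t t * (2 * Lop m s t P))
        + \<alpha> * (\<beta> * (4 * (quad m t t * ((R - 1) * Lop m s t P)) + 2 * of_nat m * (quad m t t * Lop m s t P)))"
      unfolding cup_op_def \<alpha>_def \<beta>_def
      by (simp only: Lop_diff Lop_add Lop_scal Lop_ss_quad Lop_off Eop_diag_quad P D E) simp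
    also have "\<dots> = 0" using \<alpha> by algebra
    finally show ?thesis .
  qed
  moreover have "Lop m t t (cup_op m s t r q P) = 0"
  proof -
    have "Lop m t t (cup_op m s t r q P)
      = 2 * Eop m s t P - \<beta> * (4 * ((S - 1) * Eop m s t P) + 2 * of_nat m * Eop m s t P)
        - \<alpha> * (quad m s s * (2 * Lop m s t P))
        + \<alpha> * (\<beta> * (quad m s s * (4 * ((S - 1) * Lop m s t P) + 2 * of_nat m * Lop m s t P)))"
      unfolding cup_op_def \<alpha>_def \<beta>_def
      by (simp only: Lop_diff Lop_add Lop_scal Lop_tt_quad Lop_off Eop_diag_quad P D E) simp
    also have "\<dots> = 0" using \<beta> by algebra
    finally show ?thesis .
  qed
  ultimately show ?thesis by (simp add: harm_def)
qed

text \<open>Modulo the ideal both sides are multiples of \<open>quad m s t * Eop m t s P\<close>.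
  The factor 1 - 2\<alpha> appears because \<open>Eop m t s\<close> turns the correction
  \<open>quad m s s\<close> in \<open>cup_op\<close> into \<open>2 * quad m s t\<close>, which is
  outside the ideal.\<close>

lemma raise_cup:
  assumes "harm m s t r q P"
  shows "raise_op m t s (q + 1) (cup_op m s t r q P)
    = scal (1 - 2 / (2 * r + real m - 2)) * cup_op m s t (r - 1) (q + 1) (raise_op m t s q P)"
proof -
  define \<alpha> where "\<alpha> = scal (1 / (2 * r + real m - 2))"
  define \<beta> where "\<beta> = scal (1 / (2 * q + real m - 2))"
  define \<alpha>1 where "\<alpha>1 = scal (1 / (2 * (r - 1) + real m - 2))"
  define \<beta>1 where "\<beta>1 = scal (1 / (2 * (q + 1) + real m - 2))"
  define Q where "Q = cup_op m s t r q P"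
  define R where "R = raise_op m t s q P"
  have "scal (1 - 2 * (1 / (2 * r + real m - 2))) = 1 - 2 * \<alpha>"
    unfolding scal_diff scal_mult \<alpha>_def by (simp add: scal_numeral)
  then have c: "scal (1 - 2 / (2 * r + real m - 2)) = 1 - 2 * \<alpha>" by simp
  have Q: "Q = quad m s t * P - \<alpha> * (quad m s s * Eop m t s P) - \<beta> * (quad m t t * Eop m s t P)
     + \<alpha> * (\<beta> * (quad m s s * (quad m t t * Lop m s t P)))"
    by (simp add: Q_def cup_op_def \<alpha>_def \<beta>_def)
  have R: "R = Eop m t s P - \<beta> * (quad m t t * Lop m s t P)"
    by (simp add: R_def raise_op_def \<beta>_def Lop_commute[of m t s])
  have EQ: "Eop m t s Q = (quad m s t * Eop m t s P + quad m t t * P)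
     - \<alpha> * (quad m s s * Eop m t s (Eop m t s P) + 2 * quad m s t * Eop m t s P)
     - \<beta> * (quad m t t * Eop m t s (Eop m s t P))
     + \<alpha> * (\<beta> * (quad m s s * (quad m t t * Eop m t s (Lop m s t P))
         + 2 * quad m s t * (quad m t t * Lop m s t P)))"
    unfolding Q by (simp only: \<alpha>_def \<beta>_def Eop_diff Eop_add Eop_scal Eop_off_quad)
  have e1: "raise_op m t s (q + 1) Q = Eop m t s Q - \<beta>1 * (quad m t t * Lop m s t Q)"
    by (simp add: raise_op_def \<beta>1_def Lop_commute[of m t s])
  have e2: "cup_op m s t (r - 1) (q + 1) R = quad m s t * R
     - \<alpha>1 * (quad m s s * Eop m t s R) - \<beta>1 * (quad m t t * Eop m s t R)
     + \<alpha>1 * (\<beta>1 * (quad m s s * (quad m t t * Lop m s t R)))"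
    by (simp add: cup_op_def \<alpha>1_def \<beta>1_def)
  have "raise_op m t s (q + 1) Q - (1 - 2 * \<alpha>) * cup_op m s t (r - 1) (q + 1) R
    = quad m s s * (\<alpha> * \<beta> * (quad m t t * Eop m t s (Lop m s t P)) - \<alpha> * Eop m t s (Eop m t s P)
        + (1 - 2 * \<alpha>) * \<alpha>1 * Eop m t s R - (1 - 2 * \<alpha>) * \<alpha>1 * \<beta>1 * (quad m t t * Lop m s t R))
    + quad m t t * (P - \<beta> * Eop m t s (Eop m s t P) + 2 * \<alpha> * \<beta> * quad m s t * Lop m s t P
        - \<beta>1 * Lop m s t Q + (1 - 2 * \<alpha>) * \<beta> * (quad m s t * Lop m s t P)
        + (1 - 2 * \<alpha>) * \<beta>1 * Eop m s t R)"
    \<comment> \<open>Only the \<open>R\<close> in \<open>quad m s t * R\<close> is expanded; the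
      others already carry a factor from the ideal and stay atomic in the cofactors.\<close>
    unfolding e1 e2 EQ by (subst (1) R) (simp add: algebra_simps)
  moreover have "harm m s t r (q + 2) (raise_op m t s (q + 1) Q)"
    using harm_raise_ts[OF harm_cup[OF assms]] by (simp add: Q_def add_ac)
  moreover have "harm m s t r (q + 2) (scal (1 - 2 / (2 * r + real m - 2)) * cup_op m s t (r - 1) (q + 1) R)"
    using harm_cup[OF harm_raise_ts[OF assms]] by (intro harm_scal) (simp add: R_def add_ac)
  ultimately show ?thesis
    unfolding Q_def[symmetric] R_def[symmetric] using harm_eqI c by metis
qed

text \<open>On harmonic \<open>P\<close> the operators \<open>Lop m s t\<close> and
  \<open>Eop m t s\<close> commute; the factor comes solely from the commutator of
  \<open>Lop m s t\<close> with \<open>quad m t t\<close>.\<close>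

lemma Lop_raise:
  assumes "harm m s t r q P"
  shows "Lop m s t (raise_op m t s q P)
    = scal (1 - 2 / (2 * q + real m - 2)) * raise_op m t s (q - 1) (Lop m s t P)"
proof -
  define \<beta> where "\<beta> = scal (1 / (2 * q + real m - 2))"
  define \<beta>1 where "\<beta>1 = scal (1 / (2 * (q - 1) + real m - 2))"
  have "scal (1 - 2 * (1 / (2 * q + real m - 2))) = 1 - 2 * \<beta>"
    unfolding scal_diff scal_mult \<beta>_def by (simp add: scal_numeral)
  then have c: "scal (1 - 2 / (2 * q + real m - 2)) = 1 - 2 * \<beta>" by simp
  have P: "Lop m s s P = 0" using assms by (simp add: harm_def)
  have e1: "Lop m s t (raise_op m t s q P) = Eop m t s (Lop m s t P) - \<beta> * (quad m t t * Lop m s t (Lop m s t P)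
      + 2 * Eop m t s (Lop m s t P))"
    by (simp add: raise_op_def \<beta>_def Lop_diff Lop_scal Lop_commute[of m t s] Lop_st_quad Lop_off P)
  have e2: "raise_op m t s (q - 1) (Lop m s t P)
     = Eop m t s (Lop m s t P) - \<beta>1 * (quad m t t * Lop m s t (Lop m s t P))"
    by (simp add: raise_op_def \<beta>1_def Lop_commute[of m t s])
  have "Lop m s t (raise_op m t s q P)
    - scal (1 - 2 / (2 * q + real m - 2)) * raise_op m t s (q - 1) (Lop m s t P)
    = quad m s s * 0 + quad m t t * (((1 - 2 * \<beta>) * \<beta>1 - \<beta>) * Lop m s t (Lop m s t P))"
    unfolding c e1 e2 by (simp add: algebra_simps)
  moreover have "harm m s t (r - 2) q (Lop m s t (raise_op m t s q P))"
    using harm_Lop[OF harm_raise_ts[OF assms]] by simp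
  moreover have "harm m s t (r - 2) q (scal (1 - 2 / (2 * q + real m - 2)) * raise_op m t s (q - 1) (Lop m s t P))"
    using harm_raise_ts[OF harm_Lop[OF assms]] by (intro harm_scal) simp
  ultimately show ?thesis using harm_eqI by blast
qed

text \<open>The second hypothesis puts \<open>Eop m s t P\<close> into the ideal, which removes the
  term that would involve both raising operators. The square in 1 - 4\<alpha>^2 arises since
  \<alpha> enters twice: in the correction of \<open>cup_op\<close> and in
  \<open>Eop m s t P\<close> itself.\<close>

lemma Lop_cup:
  assumes "harm m s t r q P" "raise_op m s t r P = 0"
  shows "Lop m s t (cup_op m s t r q P)
    = scal (1 - 4 / (2 * r + real m - 2)\<^sup>2) * cup_op m s t (r - 1) (q - 1) (Lop m s t P)
      + scal (r + q + real m - 2 * (r - q) / (2 * r + real m - 2)) * P"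
proof -
  define \<alpha> where "\<alpha> = scal (1 / (2 * r + real m - 2))"
  define \<alpha>1 where "\<alpha>1 = scal (1 / (2 * (r - 1) + real m - 2))"
  define \<beta>1 where "\<beta>1 = scal (1 / (2 * (q - 1) + real m - 2))"
  define D where "D = Lop m s t P"
  define R where "R = scal r"
  define S where "S = scal q"
  have "scal (1 - 4 * ((1 / (2 * r + real m - 2)) * (1 / (2 * r + real m - 2)))) = 1 - 4 * \<alpha> * \<alpha>"
    unfolding scal_diff scal_mult \<alpha>_def by (simp add: scal_numeral)
  then have c: "scal (1 - 4 / (2 * r + real m - 2)\<^sup>2) = 1 - 4 * \<alpha> * \<alpha>"
    by (simp add: power2_eq_square)
  have "scal (r + q + real m - 2 * (r - q) * (1 / (2 * r + real m - 2))) = R + S + of_nat m - 2 * (R - S) * \<alpha>"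
    unfolding scal_diff scal_mult scal_add \<alpha>_def R_def S_def by (simp add: scal_numeral scal_of_nat)
  then have d: "scal (r + q + real m - 2 * (r - q) / (2 * r + real m - 2)) = R + S + of_nat m - 2 * (R - S) * \<alpha>"
    by simp
  have P: "Eop m s s P = R * P" "Eop m t t P = S * P"
    using assms by (auto simp: harm_def bideg_def R_def S_def)
  have ES: "Eop m s t P = \<alpha> * (quad m s s * D)"
    using assms(2) by (simp add: raise_op_def \<alpha>_def D_def)
  \<comment> \<open>After substituting \<open>ES\<close>, the two terms containing the denominator 2
    q + m - 2 cancel.\<close>
  have "cup_op m s t r q P = quad m s t * P - \<alpha> * (quad m s s * Eop m t s P)"
    unfolding cup_op_def \<alpha>_def[symmetric] D_def[symmetric] ES by (simp add: algebra_simps)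
  then have e1: "Lop m s t (cup_op m s t r q P) = quad m s t * D + R * P + S * P + of_nat m * P
     - \<alpha> * (quad m s s * Lop m s t (Eop m t s P) + 2 * Eop m s t (Eop m t s P))"
    by (simp add: \<alpha>_def Lop_diff Lop_scal Lop_st_quad P D_def)
  have e2: "Eop m s t (Eop m t s P)
    = \<alpha> * (quad m s s * Eop m t s D + 2 * quad m s t * D) + R * P - S * P"
    unfolding Eop_commutator ES P by (simp add: \<alpha>_def Eop_scal Eop_off_quad)
  have e3: "cup_op m s t (r - 1) (q - 1) D = quad m s t * D
     - \<alpha>1 * (quad m s s * Eop m t s D) - \<beta>1 * (quad m t t * Eop m s t D)
     + \<alpha>1 * (\<beta>1 * (quad m s s * (quad m t t * Lop m s t D)))"
    by (simp add: cup_op_def \<alpha>1_def \<beta>1_def)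
  have "Lop m s t (cup_op m s t r q P)
    - ((1 - 4 * \<alpha> * \<alpha>) * cup_op m s t (r - 1) (q - 1) D + (R + S + of_nat m - 2 * (R - S) * \<alpha>) * P)
    = quad m s s * ((1 - 4 * \<alpha> * \<alpha>) * (\<alpha>1 * Eop m t s D - \<alpha>1 * \<beta>1 * (quad m t t * Lop m s t D))
        - \<alpha> * Lop m s t (Eop m t s P) - 2 * \<alpha> * \<alpha> * Eop m t s D)
      + quad m t t * ((1 - 4 * \<alpha> * \<alpha>) * \<beta>1 * Eop m s t D)"
    unfolding e1 e2 e3 by (simp add: algebra_simps)
  moreover have "harm m s t r q (Lop m s t (cup_op m s t r q P))"
    using harm_Lop[OF harm_cup[OF assms(1)]] by simp
  moreover have "harm m s t r q (scal (1 - 4 / (2 * r + real m - 2)\<^sup>2) * cup_op m s t (r - 1) (q - 1) D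
      + scal (r + q + real m - 2 * (r - q) / (2 * r + real m - 2)) * P)"
    using harm_cup[OF harm_Lop[OF assms(1)]] assms(1) by (intro harm_add harm_scal) (simp_all add: D_def)
  ultimately show ?thesis
    unfolding D_def[symmetric] c d using harm_eqI by blast
qed

text \<open>With \<open>Lop m s t P = 0\<close> all corrections vanish, so this is the plain gl(2)
  commutator of the polarisation operators and no reduction modulo the ideal is needed.\<close>

lemma raise_raise:
  assumes "harm m s t r q P" "Lop m s t P = 0"
  shows "raise_op m s t (r - 1) (raise_op m t s q P)
    = raise_op m t s (q - 1) (raise_op m s t r P) + scal (r - q) * P"
proof -
  have P: "Eop m s s P = scal r * P" "Eop m t t P = scal q * P" "Lop m s s P = 0" "Lop m t t P = 0"
    using assms by (auto simp: harm_def bideg_def)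
  show ?thesis
    by (simp add: raise_op_def Lop_commute[of m t s] assms(2) Lop_off P Eop_commutator scal_diff algebra_simps)
qed

end

section \<open>Identification of the projected operators\<close>

lemma block_pair_xu: "m > 4 \<Longrightarrow> block_pair m 0 m" and block_pair_ux: "m > 4 \<Longrightarrow> block_pair m m 0"
  by unfold_locales auto

context
  fixes m :: nat and r q :: real and P :: cpoly
  assumes m: "m > 4" and P: "harm m 0 m r q P"
begin

interpretation xu: block_pair m 0 m using m by (rule block_pair_xu)
interpretation ux: block_pair m m 0 using m by (rule block_pair_ux)

lemma S_x_eq: "S_x m P = raise_op m 0 m r P"
  unfolding S_x_def operator_eqs
proof (rule pi_s_eqI)
  show "Eop m 0 m P = raise_op m 0 m r P
      + quad m 0 0 * (scal (1 / (2 * r + real m - 2)) * Lop m 0 m P) + quad m m m * 0 + quad m 0 0 * (quad m m m * 0)"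
    by (simp add: raise_op_def mult.left_commute)
  show "harm m 0 m (r + 1 - 2) (q - 1) (scal (1 / (2 * r + real m - 2)) * Lop m 0 m P)"
    using xu.harm_Lop[OF P] by (intro harm_scal) simp
qed (use P xu.harm_raise[OF P] xu.bideg_Eop(1)[of r q P] in \<open>auto simp: harm_def[of _ _ _ _ _ P]\<close>)

lemma S_u_eq: "S_u m P = raise_op m m 0 q P"
  unfolding S_u_def operator_eqs
proof (rule pi_s_eqI)
  show "Eop m m 0 P = raise_op m m 0 q P
      + quad m 0 0 * 0 + quad m m m * (scal (1 / (2 * q + real m - 2)) * Lop m 0 m P) + quad m 0 0 * (quad m m m * 0)"
    by (simp add: raise_op_def mult.left_commute Lop_commute[of m m 0])
  show "harm m 0 m (r - 1) (q + 1 - 2) (scal (1 / (2 * q + real m - 2)) * Lop m 0 m P)"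
    using xu.harm_Lop[OF P] by (intro harm_scal) simp
qed (use P xu.harm_raise_ts[OF P] xu.bideg_Eop(2)[of r q P] in \<open>auto simp: harm_def[of _ _ _ _ _ P]\<close>)

lemma A_op_eq: "A_op m P = Lop m 0 m P"
  unfolding A_op_def operator_eqs
  by (rule pi_s_eqI[of _ _ _ 0 0 0]) (use xu.harm_Lop[OF P] in \<open>auto simp: harm_def[of _ _ _ _ _ "Lop m 0 m P"]\<close>)

lemma C_op_eq: "C_op m P = cup_op m 0 m r q P"
  unfolding C_op_def operator_eqs
proof (rule pi_s_eqI)
  let ?a = "scal (1 / (2 * r + real m - 2))" and ?b = "scal (1 / (2 * q + real m - 2))"
  \<comment> \<open>The Euler terms in \<open>cup_op\<close> are not harmonic. Replacing them by
    \<open>raise_op\<close> moves a multiple of |x|^2 |u|^2 into the last component twice, which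
    reverses its sign.\<close>
  show "quad m 0 m * P = cup_op m 0 m r q P + quad m 0 0 * (?a * raise_op m m 0 q P)
     + quad m m m * (?b * raise_op m 0 m r P) + quad m 0 0 * (quad m m m * (?a * (?b * Lop m 0 m P)))"
    by (simp add: raise_op_def cup_op_def Lop_commute[of m m 0] algebra_simps)
  show "harm m 0 m (r + 1 - 2) (q + 1) (?a * raise_op m m 0 q P)"
    using xu.harm_raise_ts[OF P] by (intro harm_scal) simp
  show "harm m 0 m (r + 1) (q + 1 - 2) (?b * raise_op m 0 m r P)"
    using xu.harm_raise[OF P] by (intro harm_scal) simp
  show "harm m 0 m (r + 1 - 2) (q + 1 - 2) (?a * (?b * Lop m 0 m P))"
    using xu.harm_Lop[OF P] by (intro harm_scal) simp
qed (use P xu.harm_cup[OF P] xu.bideg_quad(3)[of r q P] in \<open>auto simp: harm_def[of _ _ _ _ _ P]\<close>)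

lemma harm_ops:
  shows "harm m 0 m (r + 1) (q - 1) (S_x m P)" "harm m 0 m (r - 1) (q + 1) (S_u m P)"
    "harm m 0 m (r - 1) (q - 1) (A_op m P)" "harm m 0 m (r + 1) (q + 1) (C_op m P)"
  unfolding S_x_eq S_u_eq A_op_eq C_op_eq
  by (rule xu.harm_raise[OF P] xu.harm_raise_ts[OF P] xu.harm_Lop[OF P] xu.harm_cup[OF P])+

end

section \<open>The relations restated for the projected operators\<close>

lemma A_op_S_u:
  assumes "m > 4" "harm m 0 m r q P"
  shows "A_op m (S_u m P) = scal (1 - 2 / (2 * q + real m - 2)) * S_u m (A_op m P)"
proof -
  interpret block_pair m 0 m using assms(1) by (rule block_pair_xu)
  show ?thesis
    using Lop_raise[OF assms(2)] S_u_eq[OF assms(1) harm_ops(3)[OF assms]]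
      A_op_eq[OF assms(1) harm_ops(2)[OF assms]] S_u_eq[OF assms] A_op_eq[OF assms] by simp
qed

lemma S_u_C_op:
  assumes "m > 4" "harm m 0 m r q P"
  shows "S_u m (C_op m P) = scal (1 - 2 / (2 * r + real m - 2)) * C_op m (S_u m P)"
proof -
  interpret block_pair m 0 m using assms(1) by (rule block_pair_xu)
  show ?thesis
    using raise_cup[OF assms(2)] S_u_eq[OF assms(1) harm_ops(4)[OF assms]]
      C_op_eq[OF assms(1) harm_ops(2)[OF assms]] S_u_eq[OF assms] C_op_eq[OF assms] by simp
qed

lemma S_x_C_op:
  assumes "m > 4" "harm m 0 m r q P"
  shows "S_x m (C_op m P) = scal (1 - 2 / (2 * q + real m - 2)) * C_op m (S_x m P)"
proof -
  interpret block_pair m m 0 using assms(1) by (rule block_pair_ux)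
  show ?thesis
    using raise_cup[OF harm_swap[THEN iffD1, OF assms(2)]] S_x_eq[OF assms(1) harm_ops(4)[OF assms]]
      C_op_eq[OF assms(1) harm_ops(1)[OF assms]] S_x_eq[OF assms] C_op_eq[OF assms]
    by (simp add: cup_op_swap[of m m 0])
qed

lemma A_op_C_op:
  assumes "m > 4" "harm m 0 m r q P" "S_x m P = 0"
  shows "A_op m (C_op m P) = scal (1 - 4 / (2 * r + real m - 2)\<^sup>2) * C_op m (A_op m P)
      + scal (r + q + real m - 2 * (r - q) / (2 * r + real m - 2)) * P"
proof -
  interpret block_pair m 0 m using assms(1) by (rule block_pair_xu)
  note a = assms(1,2)
  show ?thesis
    using Lop_cup[OF assms(2)] assms(3) A_op_eq[OF assms(1) harm_ops(4)[OF a]]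
      C_op_eq[OF assms(1) harm_ops(3)[OF a]] S_x_eq[OF a] C_op_eq[OF a] A_op_eq[OF a]
    by simp
qed

lemma S_x_S_u:
  assumes "m > 4" "harm m 0 m r q P" "A_op m P = 0"
  shows "S_x m (S_u m P) = S_u m (S_x m P) + scal (r - q) * P"
proof -
  interpret block_pair m 0 m using assms(1) by (rule block_pair_xu)
  note a = assms(1,2)
  show ?thesis
    using raise_raise[OF assms(2)] assms(3) S_x_eq[OF assms(1) harm_ops(2)[OF a]]
      S_u_eq[OF assms(1) harm_ops(1)[OF a]] S_x_eq[OF a] S_u_eq[OF a] A_op_eq[OF a]
    by simp
qed

text \<open>Linearity is required only between harmonic inputs of a common bidegree: the closed
  forms depend on the degrees, and \<open>pi_s\<close> is a definite description.\<close>

definition graded :: "nat \<Rightarrow> real \<Rightarrow> real \<Rightarrow> (cpoly \<Rightarrow> cpoly) \<Rightarrow> bool" where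
  "graded m dr dq T \<longleftrightarrow> (\<forall>r q P. harm m 0 m r q P \<longrightarrow> harm m 0 m (r + dr) (q + dq) (T P)
      \<and> (\<forall>Q. harm m 0 m r q Q \<longrightarrow> T (P + Q) = T P + T Q) \<and> (\<forall>c. T (scal c * P) = scal c * T P))"

lemma gradedD:
  assumes "graded m dr dq T" "harm m 0 m r q P"
  shows "harm m 0 m (r + dr) (q + dq) (T P)" "T (scal c * P) = scal c * T P"
    and "harm m 0 m r q Q \<Longrightarrow> T (P + Q) = T P + T Q"
  using assms unfolding graded_def by blast+

lemma graded_0: "graded m dr dq T \<Longrightarrow> T 0 = 0"
  using gradedD(2)[of m dr dq T 0 0 0 0] by simp

lemma graded_sum:
  assumes "graded m dr dq T" "\<And>i. i \<in> I \<Longrightarrow> harm m 0 m r q (f i)"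
  shows "T (\<Sum>i\<in>I. f i) = (\<Sum>i\<in>I. T (f i))" "harm m 0 m r q (\<Sum>i\<in>I. f i)"
proof -
  have "T (\<Sum>i\<in>I. f i) = (\<Sum>i\<in>I. T (f i)) \<and> harm m 0 m r q (\<Sum>i\<in>I. f i)"
    using assms(2)
  proof (induction I rule: infinite_finite_induct)
    case (insert x F)
    then have "harm m 0 m r q (f x)" "harm m 0 m r q (\<Sum>i\<in>F. f i)"
      "T (\<Sum>i\<in>F. f i) = (\<Sum>i\<in>F. T (f i))" by auto
    then show ?case
      using insert(1,2) gradedD(3)[OF assms(1)] harm_add by simp
  qed (use graded_0[OF assms(1)] in auto)
  then show "T (\<Sum>i\<in>I. f i) = (\<Sum>i\<in>I. T (f i))" "harm m 0 m r q (\<Sum>i\<in>I. f i)" by auto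
qed

lemma raise_op_add: "raise_op m s t r (P + Q) = raise_op m s t r P + raise_op m s t r Q"
  by (simp add: raise_op_def Eop_add Lop_add algebra_simps)

lemma raise_op_scal: "raise_op m s t r (scal c * P) = scal c * raise_op m s t r P"
  by (simp add: raise_op_def Eop_scal Lop_scal right_diff_distrib distrib_left mult.left_commute)

lemma cup_op_add: "cup_op m s t r q (P + Q) = cup_op m s t r q P + cup_op m s t r q Q"
  by (simp add: cup_op_def Eop_add Lop_add algebra_simps)

lemma cup_op_scal: "cup_op m s t r q (scal c * P) = scal c * cup_op m s t r q P"
  by (simp add: cup_op_def Eop_scal Lop_scal right_diff_distrib distrib_left mult.left_commute)

lemma gradedI:
  assumes "\<And>r q P. harm m 0 m r q P \<Longrightarrow> harm m 0 m (r + dr) (q + dq) (T P)"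
    and "\<And>r q P Q. harm m 0 m r q P \<Longrightarrow> harm m 0 m r q Q \<Longrightarrow> T (P + Q) = T P + T Q"
    and "\<And>r q P c. harm m 0 m r q P \<Longrightarrow> T (scal c * P) = scal c * T P"
  shows "graded m dr dq T"
  using assms unfolding graded_def by blast

lemma graded_ops:
  assumes m: "m > 4"
  shows "graded m 1 (-1) (S_x m)" "graded m (-1) 1 (S_u m)"
    "graded m (-1) (-1) (A_op m)" "graded m 1 1 (C_op m)"
proof -
  show "graded m 1 (-1) (S_x m)"
    by (rule gradedI)
      (use harm_ops(1)[OF m] in \<open>simp_all add: S_x_eq[OF m] S_x_eq[OF m harm_add] S_x_eq[OF m harm_scal]
        raise_op_add raise_op_scal\<close>)
  show "graded m (-1) 1 (S_u m)"
    by (rule gradedI)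
      (use harm_ops(2)[OF m] in \<open>simp_all add: S_u_eq[OF m] S_u_eq[OF m harm_add] S_u_eq[OF m harm_scal]
        raise_op_add raise_op_scal\<close>)
  show "graded m (-1) (-1) (A_op m)"
    by (rule gradedI)
      (use harm_ops(3)[OF m] in \<open>simp_all add: A_op_eq[OF m] A_op_eq[OF m harm_add] A_op_eq[OF m harm_scal]
        Lop_add Lop_scal\<close>)
  show "graded m 1 1 (C_op m)"
    by (rule gradedI)
      (use harm_ops(4)[OF m] in \<open>simp_all add: C_op_eq[OF m] C_op_eq[OF m harm_add] C_op_eq[OF m harm_scal]
        cup_op_add cup_op_scal\<close>)
qed

lemma graded_comp:
  assumes T: "graded m a b T" and U: "graded m c d U"
  shows "graded m (c + a) (d + b) (\<lambda>P. T (U P))"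
proof (rule gradedI)
  fix r q P assume P: "harm m 0 m r q P"
  note U_P = gradedD(1)[OF U P]
  show "harm m 0 m (r + (c + a)) (q + (d + b)) (T (U P))"
    using gradedD(1)[OF T U_P] by (simp add: add_ac)
  show "T (U (scal e * P)) = scal e * T (U P)" for e
    by (simp add: gradedD(2)[OF U P] gradedD(2)[OF T U_P])
  show "T (U (P + Q)) = T (U P) + T (U Q)" if "harm m 0 m r q Q" for Q
    by (simp add: gradedD(3)[OF U P that] gradedD(3)[OF T U_P gradedD(1)[OF U that]])
qed

lemma graded_funpow:
  assumes "graded m a b T"
  shows "graded m (real n * a) (real n * b) (T ^^ n)"
proof (induction n)
  case (Suc n)
  show ?case using graded_comp[OF assms Suc] by (simp add: algebra_simps o_def)
qed (simp add: graded_def)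

section \<open>Action on the vectors generated by a simplicial harmonic\<close>

text \<open>Passing one more \<open>C_op\<close> contributes (x - 1) / x, where x grows by one each
  time, so the product telescopes to a quotient of two linear terms.\<close>

lemma S_u_C_pow:
  assumes m: "m > 4" and P: "harm m 0 m r q P" and r: "r \<ge> 0"
  shows "S_u m ((C_op m ^^ a) P)
    = scal ((r + real m / 2 - 2) / (r + real m / 2 + real a - 2)) * (C_op m ^^ a) (S_u m P)"
proof (induction a)
  case 0
  have "r + real m / 2 - 2 > 0" using m r by simp
  then show ?case by simp
next
  case (Suc a)
  have h: "harm m 0 m (r + real a) (q + real a) ((C_op m ^^ a) P)"
    using gradedD(1)[OF graded_funpow[OF graded_ops(4)[OF m]] P] by simp
  have h': "harm m 0 m (r - 1 + real a) (q + 1 + real a) ((C_op m ^^ a) (S_u m P))"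
    using gradedD(1)[OF graded_funpow[OF graded_ops(4)[OF m]] harm_ops(2)[OF m P]] by simp
  define x where "x = r + real m / 2 + real a - 1"
  have x: "x > 1" "2 * (r + real a) + real m - 2 = 2 * x" "r + real m / 2 + real a - 2 = x - 1"
    using m r by (auto simp: x_def)
  have half: "2 / (2 * x) = 1 / x" by simp
  have "S_u m ((C_op m ^^ Suc a) P) = scal (1 - 2 / (2 * x)) * C_op m (S_u m ((C_op m ^^ a) P))"
    using S_u_C_op[OF m h] x(2) by simp
  also have "C_op m (S_u m ((C_op m ^^ a) P))
      = scal ((r + real m / 2 - 2) / (x - 1)) * (C_op m ^^ Suc a) (S_u m P)"
    unfolding Suc.IH x(3) using gradedD(2)[OF graded_ops(4)[OF m] h'] by simp
  also have "scal (1 - 2 / (2 * x)) * \<dots> = scal ((1 - 1 / x) * ((r + real m / 2 - 2) / (x - 1))) * (C_op m ^^ Suc a) (S_u m P)"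
    by (simp only: half scal_mult mult.assoc)
  also have "(1 - 1 / x) * ((r + real m / 2 - 2) / (x - 1)) = (r + real m / 2 - 2) / x"
    using x(1) by (simp add: field_simps)
  also have "x = r + real m / 2 + real (Suc a) - 2" by (simp add: x_def)
  finally show ?case .
qed

lemma S_x_C_pow:
  assumes m: "m > 4" and P: "harm m 0 m r q P" and q: "q \<ge> 0"
  shows "S_x m ((C_op m ^^ a) P)
    = scal ((q + real m / 2 - 2) / (q + real m / 2 + real a - 2)) * (C_op m ^^ a) (S_x m P)"
proof (induction a)
  case 0
  have "q + real m / 2 - 2 > 0" using m q by simp
  then show ?case by simp
next
  case (Suc a)
  have h: "harm m 0 m (r + real a) (q + real a) ((C_op m ^^ a) P)"
    using gradedD(1)[OF graded_funpow[OF graded_ops(4)[OF m]] P] by simp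
  have h': "harm m 0 m (r + 1 + real a) (q - 1 + real a) ((C_op m ^^ a) (S_x m P))"
    using gradedD(1)[OF graded_funpow[OF graded_ops(4)[OF m]] harm_ops(1)[OF m P]] by simp
  define x where "x = q + real m / 2 + real a - 1"
  have x: "x > 1" "2 * (q + real a) + real m - 2 = 2 * x" "q + real m / 2 + real a - 2 = x - 1"
    using m q by (auto simp: x_def)
  have half: "2 / (2 * x) = 1 / x" by simp
  have "S_x m ((C_op m ^^ Suc a) P) = scal (1 - 2 / (2 * x)) * C_op m (S_x m ((C_op m ^^ a) P))"
    using S_x_C_op[OF m h] x(2) by simp
  also have "C_op m (S_x m ((C_op m ^^ a) P))
      = scal ((q + real m / 2 - 2) / (x - 1)) * (C_op m ^^ Suc a) (S_x m P)"
    unfolding Suc.IH x(3) using gradedD(2)[OF graded_ops(4)[OF m] h'] by simp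
  also have "scal (1 - 2 / (2 * x)) * \<dots> = scal ((1 - 1 / x) * ((q + real m / 2 - 2) / (x - 1))) * (C_op m ^^ Suc a) (S_x m P)"
    by (simp only: half scal_mult mult.assoc)
  also have "(1 - 1 / x) * ((q + real m / 2 - 2) / (x - 1)) = (q + real m / 2 - 2) / x"
    using x(1) by (simp add: field_simps)
  also have "x = q + real m / 2 + real (Suc a) - 2" by (simp add: x_def)
  finally show ?case .
qed

locale simplicial =
  fixes m k l :: nat and H :: cpoly
  assumes m: "m > 4" and H: "simp_harm m k l H"
begin

definition \<kappa> :: real where "\<kappa> = real k + real m / 2"
definition \<nu> :: real where "\<nu> = real l + real m / 2"

definition v :: "nat \<Rightarrow> nat \<Rightarrow> cpoly" where
  "v a b = (C_op m ^^ a) ((S_u m ^^ b) H)"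

text \<open>Structure constants of the ladder: \<open>S_u\<close> raises b by \<open>coef_u\<close>,
  \<open>S_x\<close> lowers b by \<open>coef_x\<close>, \<open>A_op\<close> lowers a by
  \<open>coef_A\<close>. The lowering constants vanish at index 0, which makes the truncated
  \<open>a - 1\<close> and \<open>b - 1\<close> harmless.\<close>

definition coef_u :: "nat \<Rightarrow> nat \<Rightarrow> real" where
  "coef_u a b = (\<kappa> - real b - 2) / (\<kappa> - real b + real a - 2)"

definition coef_x :: "nat \<Rightarrow> nat \<Rightarrow> real" where
  "coef_x a b = real b * (\<kappa> - \<nu> - real b + 1) * (\<nu> + real b - 2) / (\<nu> + real a + real b - 2)"

definition coef_A :: "nat \<Rightarrow> nat \<Rightarrow> real" where
  "coef_A a b = real a * (\<kappa> + \<nu> + real a - 3) * (\<kappa> + real a - 1) * (\<nu> + real a - 2)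
     / ((\<nu> + real a + real b - 2) * (\<kappa> - real b + real a - 2))"

lemma pos: "\<kappa> > 2 + real k" "\<nu> > 2 + real l"
  using m by (auto simp: \<kappa>_def \<nu>_def)

lemma harm_H: "harm m 0 m (real k) (real l) H"
  using H by (auto simp: simp_harm_def harm_def bihom_iff_bideg operator_eqs)

lemma A_H: "A_op m H = 0" and S_x_H: "S_x m H = 0"
  using H A_op_eq[OF m harm_H] S_x_eq[OF m harm_H]
  by (auto simp: simp_harm_def operator_eqs raise_op_def)

lemma harm_S_u_pow: "harm m 0 m (real k - real b) (real l + real b) ((S_u m ^^ b) H)"
  using gradedD(1)[OF graded_funpow[OF graded_ops(2)[OF m]] harm_H, of b] by simp

lemma harm_v: "harm m 0 m (real k + real a - real b) (real l + real a + real b) (v a b)"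
  using gradedD(1)[OF graded_funpow[OF graded_ops(4)[OF m]] harm_S_u_pow[of b], of a]
  by (simp add: v_def algebra_simps)

lemma A_S_u_pow: "A_op m ((S_u m ^^ b) H) = 0"
proof (induction b)
  case (Suc b)
  then show ?case
    using A_op_S_u[OF m harm_S_u_pow[of b]] graded_0[OF graded_ops(2)[OF m]] by simp
qed (simp add: A_H)

text \<open>\<open>A_op\<close> kills all these vectors, so \<open>S_x\<close> and
  \<open>S_u\<close> act as an sl(2) pair with highest weight vector \<open>H\<close> of weight k -
  l = \<kappa> - \<nu>.\<close>

lemma S_x_S_u_pow:
  "S_x m ((S_u m ^^ b) H) = scal (real b * (\<kappa> - \<nu> - real b + 1)) * (S_u m ^^ (b - 1)) H"
proof (induction b)
  case (Suc b)
  let ?c = "real b * (\<kappa> - \<nu> - real b + 1)"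
  have "S_x m ((S_u m ^^ Suc b) H) = S_u m (S_x m ((S_u m ^^ b) H))
      + scal (real k - real b - (real l + real b)) * (S_u m ^^ b) H"
    using S_x_S_u[OF m harm_S_u_pow A_S_u_pow] by simp
  also have "S_u m (S_x m ((S_u m ^^ b) H)) = scal ?c * (S_u m ^^ b) H"
    unfolding Suc.IH gradedD(2)[OF graded_ops(2)[OF m] harm_S_u_pow]
    by (cases b) auto
  also have "scal ?c * (S_u m ^^ b) H + scal (real k - real b - (real l + real b)) * (S_u m ^^ b) H
     = scal (?c + (real k - real b - (real l + real b))) * (S_u m ^^ b) H"
    by (simp only: scal_add distrib_right)
  also have "?c + (real k - real b - (real l + real b)) = real (Suc b) * (\<kappa> - \<nu> - real (Suc b) + 1)"
    by (simp add: \<kappa>_def \<nu>_def algebra_simps)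
  finally show ?case by simp
qed (simp add: S_x_H)

lemma C_v: "C_op m (v a b) = v (Suc a) b"
  by (simp add: v_def)

lemma S_u_v:
  assumes "b \<le> k"
  shows "S_u m (v a b) = scal (coef_u a b) * v a (Suc b)"
  using S_u_C_pow[OF m harm_S_u_pow[of b], of a] assms
  by (simp add: v_def coef_u_def \<kappa>_def algebra_simps)

lemma S_x_v: "S_x m (v a b) = scal (coef_x a b) * v a (b - 1)"
proof -
  let ?c = "real b * (\<kappa> - \<nu> - real b + 1)"
  have "S_x m (v a b) = scal ((\<nu> + real b - 2) / (\<nu> + real a + real b - 2))
      * (C_op m ^^ a) (scal ?c * (S_u m ^^ (b - 1)) H)"
    using S_x_C_pow[OF m harm_S_u_pow[of b], of a]
    by (simp add: v_def S_x_S_u_pow \<nu>_def add_ac)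
  also have "(C_op m ^^ a) (scal ?c * (S_u m ^^ (b - 1)) H) = scal ?c * v a (b - 1)"
    using gradedD(2)[OF graded_funpow[OF graded_ops(4)[OF m]] harm_S_u_pow] by (simp add: v_def)
  also have "scal ((\<nu> + real b - 2) / (\<nu> + real a + real b - 2)) * \<dots>
      = scal ((\<nu> + real b - 2) / (\<nu> + real a + real b - 2) * ?c) * v a (b - 1)"
    by (simp only: scal_mult mult.assoc)
  also have "(\<nu> + real b - 2) / (\<nu> + real a + real b - 2) * ?c = coef_x a b"
    by (simp add: coef_x_def)
  finally show ?thesis .
qed

text \<open>The case b = 0 comes first because \<open>S_x\<close> kills \<open>v a 0\<close>, as the
  relation between \<open>A_op\<close> and \<open>C_op\<close> demands; it then gives a first-order
  recursion in a.\<close>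

lemma A_v_0:
  "A_op m (v a 0) = scal (real a * (\<kappa> + \<nu> + real a - 3) * (\<kappa> + real a - 1) / (\<kappa> + real a - 2)) * v (a - 1) 0"
proof (induction a)
  case 0
  then show ?case by (simp add: v_def A_H)
next
  case (Suc a)
  let ?x = "\<kappa> + real a - 1"
  let ?c = "real a * (\<kappa> + \<nu> + real a - 3) * (\<kappa> + real a - 1) / (\<kappa> + real a - 2)"
  have x: "?x > 1" "2 * (real k + real a - real 0) + real m - 2 = 2 * ?x"
    using pos by (auto simp: \<kappa>_def)
  have "S_x m (v a 0) = 0" by (simp add: S_x_v coef_x_def)
  then have "A_op m (v (Suc a) 0) = scal (1 - 4 / (2 * ?x)\<^sup>2) * C_op m (A_op m (v a 0))
      + scal (real k + real a - real 0 + (real l + real a + real 0) + real m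
        - 2 * (real k + real a - real 0 - (real l + real a + real 0)) / (2 * ?x)) * v a 0"
    using A_op_C_op[OF m harm_v[of a 0]] C_v[of a 0] unfolding x by simp
  also have "C_op m (A_op m (v a 0)) = scal ?c * v a 0"
    unfolding Suc.IH gradedD(2)[OF graded_ops(4)[OF m] harm_v] C_v by (cases a) auto
  also have "scal (1 - 4 / (2 * ?x)\<^sup>2) * (scal ?c * v a 0)
      + scal (real k + real a - real 0 + (real l + real a + real 0) + real m
        - 2 * (real k + real a - real 0 - (real l + real a + real 0)) / (2 * ?x)) * v a 0
    = scal ((1 - 4 / (2 * ?x)\<^sup>2) * ?c + (\<kappa> + \<nu> + 2 * real a - (\<kappa> - \<nu>) / ?x)) * v a 0"
  proof -
    have two_ne: "2 \<noteq> (0::real)" by simp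
    have "real k + real a - real 0 + (real l + real a + real 0) + real m = \<kappa> + \<nu> + 2 * real a"
      "real k + real a - real 0 - (real l + real a + real 0) = \<kappa> - \<nu>"
      by (simp_all add: \<kappa>_def \<nu>_def)
    then have "real k + real a - real 0 + (real l + real a + real 0) + real m
        - 2 * (real k + real a - real 0 - (real l + real a + real 0)) / (2 * ?x)
      = \<kappa> + \<nu> + 2 * real a - (\<kappa> - \<nu>) / ?x"
      by (simp only: mult_divide_mult_cancel_left[of 2, OF two_ne]) 
    then show ?thesis by (simp only: scal_add scal_mult distrib_right mult.assoc)
  qed
  also have "(1 - 4 / (2 * ?x)\<^sup>2) * ?c + (\<kappa> + \<nu> + 2 * real a - (\<kappa> - \<nu>) / ?x)
    = real (Suc a) * (\<kappa> + \<nu> + real (Suc a) - 3) * (\<kappa> + real (Suc a) - 1) / (\<kappa> + real (Suc a) - 2)"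
  proof -
    define y where "y = ?x"
    define N where "N = real a * (\<kappa> + \<nu> + real a - 3)"
    have y: "y > 1" "?x = y" "\<kappa> + real a - 2 = y - 1" using x by (auto simp: y_def)
    have y_Suc: "\<kappa> + real (Suc a) - 2 = y" by (simp add: y_def)
    \<comment> \<open>The factor y - 1 cancels the denominator of the induction hypothesis, and y
      becomes the new one.\<close>
    have "1 - 4 / (2 * y)\<^sup>2 = (y - 1) * (y + 1) / (y * y)"
      using y(1) by (simp add: field_simps power2_eq_square)
    then have "(1 - 4 / (2 * y)\<^sup>2) * (N * y / (y - 1)) = N * (y + 1) / y"
      using y(1) by simp
    then have "(1 - 4 / (2 * y)\<^sup>2) * (N * y / (y - 1)) + (\<kappa> + \<nu> + 2 * real a - (\<kappa> - \<nu>) / y)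
      = (N * (y + 1) + ((\<kappa> + \<nu> + 2 * real a) * y - (\<kappa> - \<nu>))) / y"
      using y(1) by (simp add: add_divide_distrib diff_divide_distrib)
    also have "N * (y + 1) + ((\<kappa> + \<nu> + 2 * real a) * y - (\<kappa> - \<nu>))
      = real (Suc a) * (\<kappa> + \<nu> + real (Suc a) - 3) * (\<kappa> + real (Suc a) - 1)"
      by (simp add: N_def y_def algebra_simps)
    finally show ?thesis
      unfolding y(2,3) N_def[symmetric] by (simp only: y_Suc)
  qed
  finally show ?case by simp
qed

text \<open>Evaluating \<open>A_op m (S_u m (v a b))\<close> in both orders determines the value on
  \<open>v a (Suc b)\<close> after division by \<open>coef_u a b\<close>, which is nonzero as long
  as b < k.\<close>

lemma A_v:
  assumes "b \<le> k"
  shows "A_op m (v a b) = scal (coef_A a b) * v (a - 1) b"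
  using assms
proof (induction b)
  case 0
  have "\<nu> + real a - 2 > 0" using pos by simp
  then show ?case using A_v_0[of a] by (simp add: coef_A_def)
next
  case (Suc b)
  let ?y = "\<nu> + real a + real b - 1"
  have y: "?y > 1" "2 * (real l + real a + real b) + real m - 2 = 2 * ?y"
    using pos by (auto simp: \<nu>_def)
  have cu: "coef_u a b \<noteq> 0" using pos Suc.prems by (auto simp: coef_u_def)
  have "scal (coef_u a b) * A_op m (v a (Suc b)) = A_op m (S_u m (v a b))"
    unfolding S_u_v[OF Suc_leD[OF Suc.prems]] gradedD(2)[OF graded_ops(3)[OF m] harm_v] ..
  also have "\<dots> = scal (1 - 2 / (2 * ?y)) * S_u m (A_op m (v a b))"
    using A_op_S_u[OF m harm_v[of a b]] unfolding y .
  also have "S_u m (A_op m (v a b)) = scal (coef_A a b) * (scal (coef_u (a - 1) b) * v (a - 1) (Suc b))"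
    unfolding Suc.IH[OF Suc_leD[OF Suc.prems]] gradedD(2)[OF graded_ops(2)[OF m] harm_v]
      S_u_v[OF Suc_leD[OF Suc.prems]] ..
  also have "scal (1 - 2 / (2 * ?y)) * \<dots>
     = scal ((1 - 2 / (2 * ?y)) * coef_A a b * coef_u (a - 1) b) * v (a - 1) (Suc b)"
    by (simp only: scal_mult mult.assoc)
  also have "(1 - 2 / (2 * ?y)) * coef_A a b * coef_u (a - 1) b = coef_u a b * coef_A a (Suc b)"
  \<comment> \<open>For a = 0 the truncated index in \<open>coef_u (a - 1) b\<close> does not
    matter, since \<open>coef_A\<close> is zero.\<close>
  proof (cases "a = 0")
    case False
    define z where "z = \<kappa> - real b - 2"
    define w where "w = ?y"
    define N where "N = real a * (\<kappa> + \<nu> + real a - 3) * (\<kappa> + real a - 1) * (\<nu> + real a - 2)"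
    have z: "z > 0" using pos Suc.prems by (auto simp: z_def)
    have w: "w > 1" using y by (simp add: w_def)
    have e: "coef_A a b = N / ((w - 1) * (z + real a))" "coef_u (a - 1) b = z / (z + real a - 1)"
      "coef_u a b = z / (z + real a)" "coef_A a (Suc b) = N / (w * (z + real a - 1))" "real a \<ge> 1"
      using False by (auto simp: coef_A_def coef_u_def of_nat_diff N_def w_def z_def algebra_simps)
    have "(1 - 2 / (2 * w)) = (w - 1) / w" using w by (simp add: field_simps)
    then show ?thesis
      unfolding e(1-4) w_def[symmetric] using w z e(5) by (simp add: mult_ac)
  qed (simp add: coef_A_def)
  finally have "scal (coef_u a b) * A_op m (v a (Suc b))
     = scal (coef_u a b) * (scal (coef_A a (Suc b)) * v (a - 1) (Suc b))"
    by (simp only: scal_mult mult.assoc)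
  then show ?case using scal_mult_cancel[OF cu] by blast
qed

end

section \<open>The vanishing sum of coefficients\<close>

lemma sum_atMost_shift_zero:
  fixes \<phi> :: "nat \<Rightarrow> real"
  assumes "\<phi> 0 = 0" "\<phi> (Suc n) = 0"
  shows "(\<Sum>c\<le>n. \<phi> (Suc c)) = (\<Sum>c\<le>n. \<phi> c)"
  using sum.atMost_Suc_shift[of \<phi> n] sum.atMost_Suc[of \<phi> n] assms by simp

text \<open>Multiplying the summand by \<open>p * z\<close> and writing \<open>p z (y - s)\<close> as
  \<open>s y (y - s) - s (y - z) (y - p) + (p - s) (z - s) y\<close> makes the sum telescope in both directions
  at once; neither of the single sums vanishes.\<close>

lemma double_sum_vanish:
  fixes y s g h :: "nat \<Rightarrow> real" and p z :: real
  assumes s0: "s 0 = 0"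
    and g: "\<And>c. c \<le> a \<Longrightarrow> g (Suc c) * ((y 0 - y (Suc c)) * y (Suc c)) = - (g c * ((y c - z) * (y c - p)))"
    and h: "\<And>d. d \<le> b \<Longrightarrow> h (Suc d) * (s (Suc d) * (y 0 - s (Suc d))) = - (h d * ((p - s d) * (z - s d)))"
    and ya: "y a = z" and sb: "s b = p" and pz: "p * z \<noteq> 0"
  shows "(\<Sum>c\<le>a. \<Sum>d\<le>b. g c * h d * (y c - s d)) = 0"
proof -
  define \<phi> where "\<phi> c = g c * ((y 0 - y c) * y c)" for c
  define \<psi> where "\<psi> d = h d * (s d * (y 0 - s d))" for d
  have \<phi>: "(\<Sum>c\<le>a. g c * ((y c - z) * (y c - p))) = - (\<Sum>c\<le>a. \<phi> c)"
  proof -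
    \<comment> \<open>Both boundary terms vanish: \<phi> 0 contains y 0 - y 0, and \<phi> at
      \<open>Suc a\<close> is zero by the recurrence at c = a, because y a = z.\<close>
    have "(\<Sum>c\<le>a. \<phi> c) = (\<Sum>c\<le>a. \<phi> (Suc c))"
      using g[of a] ya by (intro sum_atMost_shift_zero[symmetric]) (auto simp: \<phi>_def)
    also have "\<dots> = (\<Sum>c\<le>a. - (g c * ((y c - z) * (y c - p))))"
      unfolding \<phi>_def using g by (intro sum.cong) auto
    finally show ?thesis by (simp add: sum_negf)
  qed
  have \<psi>: "(\<Sum>d\<le>b. h d * ((p - s d) * (z - s d))) = - (\<Sum>d\<le>b. \<psi> d)"
  proof -
    have "(\<Sum>d\<le>b. \<psi> d) = (\<Sum>d\<le>b. \<psi> (Suc d))"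
      using h[of b] sb s0 by (intro sum_atMost_shift_zero[symmetric]) (auto simp: \<psi>_def)
    also have "\<dots> = (\<Sum>d\<le>b. - (h d * ((p - s d) * (z - s d))))"
      unfolding \<psi>_def using h by (intro sum.cong) auto
    finally show ?thesis by (simp add: sum_negf)
  qed
  have "p * z * (\<Sum>c\<le>a. \<Sum>d\<le>b. g c * h d * (y c - s d))
     = (\<Sum>c\<le>a. \<Sum>d\<le>b. g c * h d * (s d * y c * (y c - s d))
         - g c * ((y c - z) * (y c - p)) * (h d * s d)
         + g c * y c * (h d * ((p - s d) * (z - s d))))"
    unfolding sum_distrib_left by (intro sum.cong refl) (simp add: algebra_simps)
  also have "\<dots> = (\<Sum>c\<le>a. \<Sum>d\<le>b. g c * h d * (s d * y c * (y c - s d)))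
     - (\<Sum>c\<le>a. g c * ((y c - z) * (y c - p))) * (\<Sum>d\<le>b. h d * s d)
     + (\<Sum>c\<le>a. g c * y c) * (\<Sum>d\<le>b. h d * ((p - s d) * (z - s d)))"
    by (simp only: sum.distrib sum_subtractf sum_product)
  also have "\<dots> = (\<Sum>c\<le>a. \<Sum>d\<le>b. g c * h d * (s d * y c * (y c - s d))
         + \<phi> c * (h d * s d) - g c * y c * \<psi> d)"
    unfolding \<phi> \<psi> by (simp only: sum.distrib sum_subtractf sum_product minus_mult_left[symmetric]
        minus_mult_right[symmetric] diff_minus_eq_add add_uminus_conv_diff)
  \<comment> \<open>Each summand is \<open>g c * h d * s d * y c\<close> times (y c - s d) + (y 0 -
    y c) - (y 0 - s d) = 0.\<close>
  also have "\<dots> = 0"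
    by (intro sum.neutral ballI) (simp add: \<phi>_def \<psi>_def algebra_simps)
  finally show ?thesis using pz by simp
qed

text \<open>Serves b = 0, where p = s 0 = 0 and the division by \<open>p * z\<close> is impossible.
  Here telescoping gives y 0 - z times the sum.\<close>

lemma single_sum_vanish:
  fixes y g :: "nat \<Rightarrow> real" and z :: real
  assumes g: "\<And>c. c \<le> a \<Longrightarrow> g (Suc c) * ((y 0 - y (Suc c)) * y (Suc c)) = - (g c * ((y c - z) * y c))"
    and ya: "y a = z" and ne: "y 0 \<noteq> z"
  shows "(\<Sum>c\<le>a. g c * y c) = 0"
proof -
  define \<phi> where "\<phi> c = g c * ((y 0 - y c) * y c)" for c
  have "(\<Sum>c\<le>a. \<phi> c) = (\<Sum>c\<le>a. \<phi> (Suc c))"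
    using g[of a] ya by (intro sum_atMost_shift_zero[symmetric]) (auto simp: \<phi>_def)
  also have "\<dots> = (\<Sum>c\<le>a. - (g c * ((y c - z) * y c)))"
    unfolding \<phi>_def using g by (intro sum.cong) auto
  finally have "(\<Sum>c\<le>a. \<phi> c + g c * ((y c - z) * y c)) = 0"
    by (simp add: sum_negf sum.distrib)
  also have "(\<Sum>c\<le>a. \<phi> c + g c * ((y c - z) * y c)) = (y 0 - z) * (\<Sum>c\<le>a. g c * y c)"
    unfolding sum_distrib_left by (intro sum.cong) (auto simp: \<phi>_def algebra_simps)
  finally show ?thesis using ne by simp
qed

section \<open>Falling and rising factorials\<close>

lemma falling_0 [simp]: "falling x 0 = 1"
  by (simp add: falling_def)

lemma falling_Suc: "falling x (Suc j) = falling x j * (x - real j)"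
  by (simp add: falling_def)

lemma falling_add: "falling x (i + j) = falling x i * falling (x - real i) j"
  by (induction j) (simp_all add: falling_Suc algebra_simps)

lemma falling_minus_1: "falling (x - 1) j * x = falling x j * (x - real j)"
  using falling_add[of x 1 j] by (simp add: falling_Suc mult.commute falling_def)

lemma falling_eq_pochhammer: "falling (x + real j - 1) j = pochhammer x j"
proof (induction j)
  case (Suc j)
  have "falling (x + real (Suc j) - 1) (Suc j) = falling (x + real j) (Suc j)" by simp
  also have "\<dots> = falling (x + real j) 1 * falling (x + real j - 1) j"
    using falling_add[of "x + real j" 1 j] by simp
  also have "\<dots> = pochhammer x (Suc j)"
    using Suc.IH by (simp add: falling_Suc pochhammer_Suc mult.commute)
  finally show ?case .
qed simp

lemma falling_pos: "x > real j - 1 \<Longrightarrow> falling x j > 0"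
  unfolding falling_def by (intro prod_pos) auto

context simplicial
begin

text \<open>The \<open>(c, d)\<close> term of \<open>Pi_kl\<close> on \<open>v a b\<close> splits as \<open>g c * h d * (y c - s d)\<close>, where only the last
  factor mixes \<open>c\<close> and \<open>d\<close>.\<close>

definition g_seq :: "nat \<Rightarrow> nat \<Rightarrow> nat \<Rightarrow> real" where
  "g_seq a b c = (-1) ^ c / fact c *
     (falling (real a) c * falling (\<kappa> + \<nu> + real a - 3) c * falling (\<kappa> + real a - 1) c * falling (\<nu> + real a - 2) c)
     / (falling (\<nu> + real a + real b - 3) c * falling (\<kappa> + \<nu> + 2 * real a - 4) c
         * falling (\<kappa> + real a - real b - 2) c)"

text \<open>The additional factor in each \<open>Suc d\<close> product comes from a denominator in d
  alone: one is in \<open>beta_coef\<close>, the other is left over from a quotient of falling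
  factorials shifted by one.\<close>

definition h_seq :: "nat \<Rightarrow> nat \<Rightarrow> nat \<Rightarrow> real" where
  "h_seq a b d = (-1) ^ d / fact d *
     (falling (real b) d * pochhammer (\<kappa> - \<nu> - real b + 1) d * falling (\<nu> + real b - 2) d * pochhammer (\<kappa> - real b - 1) d)
     / (pochhammer (\<kappa> - \<nu> - 2 * real b + 2) d * falling (\<nu> + real a + real b - 2) (Suc d)
         * pochhammer (\<kappa> + real a - real b - 1) (Suc d))"

lemma g_seq_Suc:
  "g_seq a b (Suc c) = - (g_seq a b c
     * ((real a - real c) * (\<kappa> + \<nu> + real a - 3 - real c) * (\<kappa> + real a - 1 - real c) * (\<nu> + real a - 2 - real c))
     / ((real c + 1) * (\<kappa> + \<nu> + 2 * real a - 4 - real c) * (\<kappa> + real a - real b - 2 - real c)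
         * (\<nu> + real a + real b - 3 - real c)))"
  unfolding g_seq_def falling_Suc fact_Suc power_Suc by (simp add: mult_ac add_ac)

lemma h_seq_Suc:
  "h_seq a b (Suc d) = - (h_seq a b d
     * ((real b - real d) * (\<kappa> - \<nu> - real b + 1 + real d) * (\<nu> + real b - 2 - real d) * (\<kappa> - real b - 1 + real d))
     / ((real d + 1) * (\<kappa> - \<nu> - 2 * real b + 2 + real d) * (\<nu> + real a + real b - 2 - real (Suc d))
         * (\<kappa> + real a - real b - 1 + real (Suc d))))"
  unfolding h_seq_def falling_Suc pochhammer_Suc fact_Suc power_Suc by (simp add: mult_ac add_ac)

text \<open>With A = \<kappa> + a - b - 1 and B = \<nu> + a + b - 2, the mixed terms c d cancel in
  (A + d - c) (B - d - c); what remains is \<open>y_seq\<close>, a function of c, minus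
  \<open>s_seq\<close>, a function of d.\<close>

definition y_seq :: "nat \<Rightarrow> nat \<Rightarrow> nat \<Rightarrow> real" where
  "y_seq a b c = (\<kappa> + real a - real b - 1 - real c) * (\<nu> + real a + real b - 2 - real c)"

definition s_seq :: "nat \<Rightarrow> nat \<Rightarrow> real" where
  "s_seq b d = real d * (\<kappa> - \<nu> - 2 * real b + 1 + real d)"

text \<open>The differences of \<open>y_seq\<close> and \<open>s_seq\<close> split into linear
  factors, and these are exactly the factors in the term ratio of \<open>g_seq\<close>.\<close>

lemma g_seq_recurrence:
  assumes "c \<le> a" "b \<le> k"
  shows "g_seq a b (Suc c) * ((y_seq a b 0 - y_seq a b (Suc c)) * y_seq a b (Suc c))
    = - (g_seq a b c * ((y_seq a b c - y_seq a b a) * (y_seq a b c - s_seq b b)))"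
proof -
  define n1 where "n1 = real a - real c"
  define n2 where "n2 = \<kappa> + \<nu> + real a - 3 - real c"
  define n3 where "n3 = \<kappa> + real a - 1 - real c"
  define n4 where "n4 = \<nu> + real a - 2 - real c"
  define d2 where "d2 = \<kappa> + \<nu> + 2 * real a - 4 - real c"
  define d3 where "d3 = \<kappa> + real a - real b - 2 - real c"
  define d4 where "d4 = \<nu> + real a + real b - 3 - real c"
  have y: "y_seq a b 0 - y_seq a b (Suc c) = (real c + 1) * d2" "y_seq a b (Suc c) = d3 * d4"
    "y_seq a b c - y_seq a b a = n1 * n2" "y_seq a b c - s_seq b b = n3 * n4"
    by (simp_all add: y_seq_def s_seq_def n1_def n2_def n3_def n4_def d2_def d3_def d4_def algebra_simps)
  have g: "g_seq a b (Suc c) = - (g_seq a b c * (n1 * n2 * n3 * n4) / ((real c + 1) * d2 * d3 * d4))"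
    unfolding g_seq_Suc n1_def n2_def n3_def n4_def d2_def d3_def d4_def ..
  show ?thesis
  \<comment> \<open>At c = a the denominator \<open>d4\<close> can be zero, but
    \<open>n1 = 0\<close> makes both sides vanish.\<close>
  proof (cases "c = a")
    case True
    then have "n1 = 0" by (simp add: n1_def)
    then show ?thesis unfolding y(1) unfolding y(2-) g by simp
  next
    case False
    then have "d2 > 0" "d3 > 0" "d4 > 0"
      using pos assms by (auto simp: d2_def d3_def d4_def)
    moreover have "real c + 1 \<noteq> 0" by simp
    ultimately show ?thesis unfolding y(1) unfolding y(2-) g by (simp add: mult_ac)
  qed
qed

text \<open>Counterpart in d. The bound \<open>l + 2 * b \<le> k\<close> keeps \<open>d2\<close>
  positive, and at d = b, where \<open>d3\<close> can be zero, \<open>n1\<close> vanishes.\<close>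

lemma h_seq_recurrence:
  assumes "d \<le> b" "b \<le> k" "l + 2 * b \<le> k"
  shows "h_seq a b (Suc d) * (s_seq b (Suc d) * (y_seq a b 0 - s_seq b (Suc d)))
    = - (h_seq a b d * ((s_seq b b - s_seq b d) * (y_seq a b a - s_seq b d)))"
proof -
  define n1 where "n1 = real b - real d"
  define n2 where "n2 = \<kappa> - \<nu> - real b + 1 + real d"
  define n3 where "n3 = \<nu> + real b - 2 - real d"
  define n4 where "n4 = \<kappa> - real b - 1 + real d"
  define d2 where "d2 = \<kappa> - \<nu> - 2 * real b + 2 + real d"
  define d3 where "d3 = \<nu> + real a + real b - 2 - real (Suc d)"
  define d4 where "d4 = \<kappa> + real a - real b - 1 + real (Suc d)"
  have y: "s_seq b (Suc d) = (real d + 1) * d2" "y_seq a b 0 - s_seq b (Suc d) = d3 * d4"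
    "s_seq b b - s_seq b d = n1 * n2" "y_seq a b a - s_seq b d = n3 * n4"
    by (simp_all add: y_seq_def s_seq_def n1_def n2_def n3_def n4_def d2_def d3_def d4_def algebra_simps)
  have h: "h_seq a b (Suc d) = - (h_seq a b d * (n1 * n2 * n3 * n4) / ((real d + 1) * d2 * d3 * d4))"
    unfolding h_seq_Suc n1_def n2_def n3_def n4_def d2_def d3_def d4_def ..
  show ?thesis
  proof (cases "d = b")
    case True
    then have "n1 = 0" by (simp add: n1_def)
    then show ?thesis unfolding y(3) h by simp
  next
    case False
    have "d2 > 0" using assms(3) by (simp add: d2_def \<kappa>_def \<nu>_def)
    moreover have "d3 > 0" "d4 > 0"
      using False pos assms by (auto simp: d3_def d4_def)
    moreover have "real d + 1 \<noteq> 0" by simp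
    ultimately show ?thesis unfolding y(2) unfolding y(1,3,4) h by (simp add: mult_ac)
  qed
qed

text \<open>The eigenvalue of C^c S_u^d A^c S_x^d on \<open>v a b\<close>: d steps down in b, c
  steps down in a, d steps up in b. The final steps up by \<open>C_op\<close> have constant
  1.\<close>

definition sandwich :: "nat \<Rightarrow> nat \<Rightarrow> nat \<Rightarrow> nat \<Rightarrow> real" where
  "sandwich a b c d = (\<Prod>t<d. coef_x a (b - t)) * (\<Prod>t<c. coef_A (a - t) (b - d))
     * (\<Prod>t<d. coef_u (a - c) (b - d + t))"

lemma prod_coef_x:
  assumes "d \<le> b"
  shows "(\<Prod>t<d. coef_x a (b - t)) = falling (real b) d * pochhammer (\<kappa> - \<nu> - real b + 1) d
     * falling (\<nu> + real b - 2) d / falling (\<nu> + real a + real b - 2) d"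
proof -
  have "(\<Prod>t<d. coef_x a (b - t)) = (\<Prod>t<d. (real b - real t) * (\<kappa> - \<nu> - real b + 1 + real t)
      * (\<nu> + real b - 2 - real t) / (\<nu> + real a + real b - 2 - real t))"
    using assms by (intro prod.cong refl) (simp add: coef_x_def of_nat_diff algebra_simps)
  then show ?thesis
    by (simp add: prod.distrib prod_dividef falling_def pochhammer_prod atLeast0LessThan)
qed

lemma prod_coef_A:
  assumes "c \<le> a"
  shows "(\<Prod>t<c. coef_A (a - t) b) = falling (real a) c * falling (\<kappa> + \<nu> + real a - 3) c
     * falling (\<kappa> + real a - 1) c * falling (\<nu> + real a - 2) c
     / (falling (\<nu> + real a + real b - 2) c * falling (\<kappa> - real b + real a - 2) c)"
proof -
  have "(\<Prod>t<c. coef_A (a - t) b) = (\<Prod>t<c. (real a - real t) * (\<kappa> + \<nu> + real a - 3 - real t)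
      * (\<kappa> + real a - 1 - real t) * (\<nu> + real a - 2 - real t)
      / ((\<nu> + real a + real b - 2 - real t) * (\<kappa> - real b + real a - 2 - real t)))"
    using assms by (intro prod.cong refl) (simp add: coef_A_def of_nat_diff algebra_simps)
  then show ?thesis
    by (simp add: prod.distrib prod_dividef falling_def)
qed

lemma prod_coef_u:
  assumes "d \<le> b"
  shows "(\<Prod>t<d. coef_u a (b - d + t))
    = falling (\<kappa> - real b + real d - 2) d / falling (\<kappa> - real b + real d - 2 + real a) d"
proof -
  have "(\<Prod>t<d. coef_u a (b - d + t)) = (\<Prod>t<d. (\<kappa> - real b + real d - 2 - real t)
      / (\<kappa> - real b + real d - 2 + real a - real t))"
    using assms by (intro prod.cong refl) (simp add: coef_u_def of_nat_diff algebra_simps)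
  then show ?thesis by (simp add: prod_dividef falling_def)
qed

text \<open>Separation of variables: (K, L) is the bidegree of \<open>v a b\<close>, and the factors
  mixing c and d in \<open>beta_coef\<close> and \<open>sandwich\<close> cancel except for two
  linear ones, whose product is \<open>y_seq\<close> minus \<open>s_seq\<close>.\<close>

lemma beta_sandwich:
  assumes "c \<le> a" "d \<le> b" "b \<le> k" "K + b = k + a" "L = l + a + b"
  shows "beta_coef m K L c d * sandwich a b c d
    = g_seq a b c * h_seq a b d * (y_seq a b c - s_seq b d)"
proof -
  define Y where "Y = \<nu> + real a + real b - 2 - real d"
  define X where "X = \<kappa> + real a - real b - 1 + real d - 1"
  define e where "e = \<kappa> + real a - real b - 1 + real d"
  define D1 where "D1 = falling (\<nu> + real a + real b - 3) c"
  define D2 where "D2 = falling (\<kappa> + \<nu> + 2 * real a - 4) c"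
  define D3 where "D3 = pochhammer (\<kappa> - \<nu> - 2 * real b + 2) d"
  define N1 where "N1 = falling (real a) c * falling (\<kappa> + \<nu> + real a - 3) c
     * falling (\<kappa> + real a - 1) c * falling (\<nu> + real a - 2) c"
  define B1 where "B1 = falling (real b) d * pochhammer (\<kappa> - \<nu> - real b + 1) d * falling (\<nu> + real b - 2) d"
  define U where "U = pochhammer (\<kappa> - real b - 1) d"
  define W where "W = falling (\<nu> + real a + real b - 2) d"
  define Q where "Q = pochhammer (\<kappa> + real a - real b - 1) d"
  define X1 where "X1 = falling (\<kappa> + real a - real b - 2) c"
  have KL: "real K = real k + real a - real b" "real L = real l + real a + real b"
    using assms(4,5) by auto
  have b1: "beta_coef m K L c d = (-1) ^ (c + d) / (fact c * fact d) *
     ((e - real c) * falling (Y - 1) c) / (e * D1 * D2 * D3)"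
    unfolding beta_coef_def KL e_def Y_def D1_def D2_def D3_def \<kappa>_def \<nu>_def
    by (simp add: algebra_simps)
  have b2: "sandwich a b c d = B1 / W * (N1 / (falling Y c * falling X c)) * (U / falling (X - real c) d)"
  proof -
    have *: "real (b - d) = real b - real d" "real (a - c) = real a - real c" using assms(1,2) by auto
    have u: "U = falling (\<kappa> - real b + real d - 2) d"
      unfolding U_def falling_eq_pochhammer[symmetric] by (simp add: algebra_simps)
    have e: "\<nu> + real a + real (b - d) - 2 = Y" "\<kappa> - real (b - d) + real a - 2 = X"
      "\<kappa> - real b + real d - 2 + real (a - c) = X - real c"
      by (simp_all add: * Y_def X_def)
    show ?thesis
      unfolding sandwich_def prod_coef_x[OF assms(2)] prod_coef_A[OF assms(1)] prod_coef_u[OF assms(2)]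
        e u[symmetric] B1_def W_def N1_def ..
  qed
  \<comment> \<open>\<open>Y\<close> depends on d. The two products overlap in all but their end
    factors, so only a linear factor still mixes c and d.\<close>
  have b3: "falling (Y - 1) c / falling Y c = (Y - real c) / Y"
  proof -
    have "Y > real c - 1" "Y > 0" using assms pos by (auto simp: Y_def)
    then have "falling Y c > 0" "Y > 0" by (auto intro: falling_pos)
    then show ?thesis using falling_minus_1[of Y c] by (simp add: field_simps)
  qed
  \<comment> \<open>Taking the d largest of the c + d consecutive factors first leaves
    \<open>Q\<close> depending on d only and \<open>X1\<close> on c only.\<close>
  have b4: "falling X c * falling (X - real c) d = Q * X1"
  proof -
    have "falling X c * falling (X - real c) d = falling X d * falling (X - real d) c"
      using falling_add[of X c d] falling_add[of X d c] by (simp add: add.commute)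
    also have "falling X d = Q" unfolding X_def Q_def by (rule falling_eq_pochhammer)
    also have "X - real d = \<kappa> + real a - real b - 2" by (simp add: X_def)
    finally show ?thesis by (simp add: X1_def)
  qed
  have "beta_coef m K L c d * sandwich a b c d
      = (-1) ^ (c + d) / (fact c * fact d) * (e - real c) / (e * D1 * D2 * D3) * (B1 / W)
        * N1 * U * (falling (Y - 1) c / falling Y c) / (falling X c * falling (X - real c) d)"
    unfolding b1 b2 by (simp add: mult_ac)
  also have "\<dots> = (-1) ^ (c + d) / (fact c * fact d) * (e - real c) / (e * D1 * D2 * D3) * (B1 / W)
        * N1 * U * ((Y - real c) / Y) / (Q * X1)"
    unfolding b3 b4 ..
  also have "\<dots> = g_seq a b c * h_seq a b d * ((e - real c) * (Y - real c))"
  proof -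
    have "g_seq a b c = (-1) ^ c / fact c * N1 / (D1 * D2 * X1)"
      by (simp add: g_seq_def N1_def D1_def D2_def X1_def)
    moreover have "h_seq a b d = (-1) ^ d / fact d * (B1 * U) / (D3 * (W * Y) * (Q * e))"
      by (simp add: h_seq_def B1_def U_def D3_def W_def Y_def Q_def e_def falling_Suc pochhammer_Suc)
    ultimately show ?thesis by (simp add: power_add mult_ac)
  qed
  also have "(e - real c) * (Y - real c) = y_seq a b c - s_seq b d"
    by (simp add: e_def Y_def y_seq_def s_seq_def algebra_simps)
  finally show ?thesis .
qed

text \<open>\<open>L \<le> K\<close> amounts to l + 2 b \<le> k. For b > 0 it also makes
  \<open>s_seq b b\<close> positive, as the double sum argument needs; for b = 0 this value is zero
  and the single sum takes over.\<close>

lemma beta_sum: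
  assumes "b \<le> k" "K + b = k + a" "L = l + a + b" "L \<le> K"
  shows "(\<Sum>c\<le>a. \<Sum>d\<le>b. beta_coef m K L c d * sandwich a b c d) = (if a = 0 \<and> b = 0 then 1 else 0)"
proof (cases "a = 0 \<and> b = 0")
  case True
  have "real k + real m / 2 - 1 > 0" using m by simp
  then show ?thesis using True assms by (simp add: beta_coef_def sandwich_def)
next
  case False
  have lb: "l + 2 * b \<le> k" using assms by auto
  have "(\<Sum>c\<le>a. \<Sum>d\<le>b. beta_coef m K L c d * sandwich a b c d)
      = (\<Sum>c\<le>a. \<Sum>d\<le>b. g_seq a b c * h_seq a b d * (y_seq a b c - s_seq b d))"
    using assms by (intro sum.cong refl) (simp add: beta_sandwich)
  also have "\<dots> = 0"
  proof (cases "b = 0")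
    case True
    have "y_seq a b 0 - y_seq a b a = real a * (\<kappa> + \<nu> + real a - 3)"
      by (simp add: y_seq_def algebra_simps)
    moreover have "real a * (\<kappa> + \<nu> + real a - 3) > 0" using False True pos by simp
    ultimately have "y_seq a b 0 \<noteq> y_seq a b a" by auto
    then have "(\<Sum>c\<le>a. g_seq a b c * y_seq a b c) = 0"
      using g_seq_recurrence[OF _ assms(1), of _ a] True
      by (intro single_sum_vanish[of a _ _ "y_seq a b a"]) (auto simp: s_seq_def)
    moreover have "(\<Sum>c\<le>a. \<Sum>d\<le>b. g_seq a b c * h_seq a b d * (y_seq a b c - s_seq b d))
      = h_seq a b 0 * (\<Sum>c\<le>a. g_seq a b c * y_seq a b c)"
      using True by (simp add: s_seq_def sum_distrib_left mult_ac)
    ultimately show ?thesis by simp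
  next
    case b: False
    have r: "\<kappa> - \<nu> - 2 * real b \<ge> 0" using lb by (simp add: \<kappa>_def \<nu>_def)
    have "s_seq b b > 0" using r b unfolding s_seq_def by (intro mult_pos_pos) auto
    moreover have "y_seq a b a > 0" using pos assms(1) by (auto simp: y_seq_def intro!: mult_pos_pos)
    ultimately have "s_seq b b * y_seq a b a \<noteq> 0" by simp
    then show ?thesis
      by (intro double_sum_vanish[of "s_seq b" a "g_seq a b" "y_seq a b" "y_seq a b a" "s_seq b b" b "h_seq a b"])
        (use g_seq_recurrence h_seq_recurrence assms(1) lb in \<open>auto simp: s_seq_def[of b 0]\<close>)
  qed
  finally show ?thesis using False by auto
qed

end

section \<open>The projection formula\<close>

lemma scal_sum: "scal (\<Sum>i\<in>I. f i) = (\<Sum>i\<in>I. scal (f i))"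
  by (induction I rule: infinite_finite_induct) (auto simp: scal_add)

context simplicial
begin

section \<open>Iterated steps on the ladder\<close>

lemma S_x_pow_v: "(S_x m ^^ d) (v a b) = scal (\<Prod>t<d. coef_x a (b - t)) * v a (b - d)"
proof (induction d)
  case (Suc d)
  have "(S_x m ^^ Suc d) (v a b)
      = scal (\<Prod>t<d. coef_x a (b - t)) * (scal (coef_x a (b - d)) * v a (b - d - 1))"
    using Suc gradedD(2)[OF graded_ops(1)[OF m] harm_v] by (simp add: S_x_v)
  then show ?case by (simp add: scal_mult mult.assoc)
qed simp

lemma A_pow_v:
  assumes "b \<le> k"
  shows "(A_op m ^^ c) (v a b) = scal (\<Prod>t<c. coef_A (a - t) b) * v (a - c) b"
proof (induction c)
  case (Suc c)
  have "(A_op m ^^ Suc c) (v a b)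
      = scal (\<Prod>t<c. coef_A (a - t) b) * (scal (coef_A (a - c) b) * v (a - c - 1) b)"
    using Suc gradedD(2)[OF graded_ops(3)[OF m] harm_v] A_v[OF assms] by simp
  then show ?case by (simp add: scal_mult mult.assoc)
qed simp

lemma S_u_pow_v:
  assumes "b + d \<le> k"
  shows "(S_u m ^^ d) (v a b) = scal (\<Prod>t<d. coef_u a (b + t)) * v a (b + d)"
  using assms
proof (induction d)
  case (Suc d)
  have "(S_u m ^^ Suc d) (v a b)
      = scal (\<Prod>t<d. coef_u a (b + t)) * (scal (coef_u a (b + d)) * v a (Suc (b + d)))"
    using Suc gradedD(2)[OF graded_ops(2)[OF m] harm_v] S_u_v[of "b + d"] by simp
  then show ?case by (simp add: scal_mult mult.assoc)
qed simp

lemma C_pow_v: "(C_op m ^^ c) (v a b) = v (c + a) b"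
  by (simp add: v_def funpow_add)

lemma A_pow_S_x_pow_v:
  assumes "b \<le> k"
  shows "(A_op m ^^ c) ((S_x m ^^ d) (v a b))
    = scal ((\<Prod>t<d. coef_x a (b - t)) * (\<Prod>t<c. coef_A (a - t) (b - d))) * v (a - c) (b - d)"
proof -
  have "(A_op m ^^ c) ((S_x m ^^ d) (v a b))
      = scal (\<Prod>t<d. coef_x a (b - t)) * (A_op m ^^ c) (v a (b - d))"
    unfolding S_x_pow_v by (rule gradedD(2)[OF graded_funpow[OF graded_ops(3)[OF m]] harm_v])
  then show ?thesis using assms by (simp add: A_pow_v scal_mult mult.assoc)
qed

text \<open>Stepping below the bottom of the ladder passes index 0, where the lowering coefficient
  is zero.\<close>

lemma A_pow_S_x_pow_v_zero:
  assumes "b \<le> k" "a < c \<or> b < d"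
  shows "(A_op m ^^ c) ((S_x m ^^ d) (v a b)) = 0"
proof -
  have "(\<Prod>t<d. coef_x a (b - t)) = 0 \<or> (\<Prod>t<c. coef_A (a - t) (b - d)) = 0"
    using assms(2) by (auto simp: coef_x_def coef_A_def intro: exI[of _ a] exI[of _ b])
  then have "(\<Prod>t<d. coef_x a (b - t)) * (\<Prod>t<c. coef_A (a - t) (b - d)) = 0"
    by (simp only: mult_eq_0_iff)
  then show ?thesis unfolding A_pow_S_x_pow_v[OF assms(1)] by (simp only: scal_0 mult_zero_left)
qed

lemma sandwich_v:
  assumes "c \<le> a" "d \<le> b" "b \<le> k"
  shows "(C_op m ^^ c) ((S_u m ^^ d) ((A_op m ^^ c) ((S_x m ^^ d) (v a b))))
    = scal (sandwich a b c d) * v a b"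
proof -
  let ?X = "(\<Prod>t<d. coef_x a (b - t)) * (\<Prod>t<c. coef_A (a - t) (b - d))"
  let ?U = "\<Prod>t<d. coef_u (a - c) (b - d + t)"
  have "(S_u m ^^ d) ((A_op m ^^ c) ((S_x m ^^ d) (v a b))) = scal ?X * (scal ?U * v (a - c) b)"
    unfolding A_pow_S_x_pow_v[OF assms(3)]
      gradedD(2)[OF graded_funpow[OF graded_ops(2)[OF m]] harm_v]
    using S_u_pow_v[of "b - d" d "a - c"] assms by simp
  also have "\<dots> = scal (sandwich a b c d) * v (a - c) b"
    by (simp only: sandwich_def scal_mult mult.assoc)
  finally have "(C_op m ^^ c) ((S_u m ^^ d) ((A_op m ^^ c) ((S_x m ^^ d) (v a b))))
      = scal (sandwich a b c d) * (C_op m ^^ c) (v (a - c) b)"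
    by (simp only: gradedD(2)[OF graded_funpow[OF graded_ops(4)[OF m]] harm_v])
  then show ?thesis using assms(1) by (simp add: C_pow_v)
qed

lemma Pi_kl_v:
  assumes "b \<le> k" "K + b = k + a" "L = l + a + b" "L \<le> K"
  shows "Pi_kl m K L (v a b) = (if a = 0 \<and> b = 0 then H else 0)"
proof -
  let ?T = "\<lambda>c d. (C_op m ^^ c) ((S_u m ^^ d) ((A_op m ^^ c) ((S_x m ^^ d) (v a b))))"
  have T0: "?T c d = 0" if "a < c \<or> b < d" for c d
    unfolding A_pow_S_x_pow_v_zero[OF assms(1) that]
    using graded_0[OF graded_funpow[OF graded_ops(2)[OF m]]]
      graded_0[OF graded_funpow[OF graded_ops(4)[OF m]]] by simp
  have "Pi_kl m K L (v a b) = (\<Sum>c\<le>L. \<Sum>d\<le>L. scal (beta_coef m K L c d) * ?T c d)"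
    by (simp add: Pi_kl_def map_mult_scal)
  also have "\<dots> = (\<Sum>c\<le>a. \<Sum>d\<le>b. scal (beta_coef m K L c d) * ?T c d)"
  proof (rule sum.mono_neutral_cong_right)
    show "\<forall>c\<in>{..L} - {..a}. (\<Sum>d\<le>L. scal (beta_coef m K L c d) * ?T c d) = 0"
      using T0 by (intro ballI sum.neutral) auto
    show "(\<Sum>d\<le>L. scal (beta_coef m K L c d) * ?T c d) = (\<Sum>d\<le>b. scal (beta_coef m K L c d) * ?T c d)" for c
      using T0 assms(3) by (intro sum.mono_neutral_right) auto
  qed (use assms(3) in auto)
  also have "\<dots> = (\<Sum>c\<le>a. \<Sum>d\<le>b. scal (beta_coef m K L c d * sandwich a b c d) * v a b)"
    using assms(1) by (intro sum.cong refl) (simp add: sandwich_v scal_mult mult.assoc)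
  also have "\<dots> = scal (\<Sum>c\<le>a. \<Sum>d\<le>b. beta_coef m K L c d * sandwich a b c d) * v a b"
    by (simp add: scal_sum sum_distrib_right)
  finally show ?thesis
    unfolding beta_sum[OF assms] by (auto simp: v_def)
qed

text \<open>This identifies the normalising constant: it is the product of the lowering coefficients
  on the way from \<open>v i j\<close> down to \<open>v 0 0 = H\<close>.\<close>

lemma alpha_coef_eq:
  "(\<Prod>t<j. coef_x i (j - t)) * (\<Prod>t<i. coef_A (i - t) 0) = alpha_coef m i j k l"
proof -
  have e: "real k + real m / 2 + real i - 1 = \<kappa> + real i - 1" "real k + real m / 2 + real i - 2 = \<kappa> + real i - 2"
    "real l + real m / 2 + real j - 2 = \<nu> + real j - 2" "real l + real m / 2 + real i - 2 = \<nu> + real i - 2"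
    "real l + real m / 2 + real i + real j - 2 = \<nu> + real i + real j - 2"
    "real k + real l + real m + real i - 3 = \<kappa> + \<nu> + real i - 3"
    "real k - real l - real j + 1 = \<kappa> - \<nu> - real j + 1"
    by (simp_all add: \<kappa>_def \<nu>_def)
  show ?thesis
    using prod_coef_x[of j j i] prod_coef_A[of i i 0]
    unfolding alpha_coef_def e by (simp add: mult_ac)
qed

text \<open>Every single lowering coefficient on that way is positive, so the normalisation in
  \<open>Pi_ij\<close> divides by a nonzero number.\<close>

lemma alpha_coef_pos:
  assumes "l + j \<le> k"
  shows "alpha_coef m i j k l > 0"
proof -
  have r: "\<kappa> - \<nu> - real j \<ge> 0" using assms by (simp add: \<kappa>_def \<nu>_def)
  have "coef_x i (j - t) > 0" if "t < j" for t
    using that pos r unfolding coef_x_def by (intro divide_pos_pos mult_pos_pos) (auto simp: of_nat_diff)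
  moreover have "coef_A (i - t) 0 > 0" if "t < i" for t
    using that pos unfolding coef_A_def by (intro divide_pos_pos mult_pos_pos) (auto simp: of_nat_diff)
  ultimately show ?thesis
    unfolding alpha_coef_eq[symmetric] by (intro mult_pos_pos prod_pos) auto
qed

end

section \<open>Linearity of the projections and their value on a component\<close>

lemma graded_sum_ops:
  assumes "\<And>i. i \<in> I \<Longrightarrow> graded m dr dq (T i)"
  shows "graded m dr dq (\<lambda>P. \<Sum>i\<in>I. T i P)"
  using assms
proof (induction I rule: infinite_finite_induct)
  case (insert x F)
  then have x: "graded m dr dq (T x)" and F: "graded m dr dq (\<lambda>P. \<Sum>i\<in>F. T i P)" by auto
  show ?case
    unfolding sum.insert[OF insert(1,2)]
    by (rule gradedI)
      (auto intro: harm_add gradedD(1)[OF x] gradedD(1)[OF F]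
        simp: gradedD(2)[OF x] gradedD(2)[OF F] gradedD(3)[OF x] gradedD(3)[OF F] distrib_left)
qed (simp_all add: graded_def)

lemma graded_scal:
  assumes "graded m dr dq T"
  shows "graded m dr dq (\<lambda>P. scal c * T P)"
  by (rule gradedI)
    (auto intro: harm_scal gradedD(1)[OF assms]
      simp: gradedD(2)[OF assms] gradedD(3)[OF assms] distrib_left mult.left_commute)

lemma graded_Pi_kl:
  assumes m: "m > 4"
  shows "graded m 0 0 (Pi_kl m k l)"
  unfolding Pi_kl_def map_mult_scal
proof (intro graded_sum_ops graded_scal)
  fix a b
  show "graded m 0 0 (\<lambda>P. (C_op m ^^ a) ((S_u m ^^ b) ((A_op m ^^ a) ((S_x m ^^ b) P))))"
      using graded_comp[OF graded_funpow[OF graded_ops(4)[OF m], of a]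
          graded_comp[OF graded_funpow[OF graded_ops(2)[OF m], of b]
          graded_comp[OF graded_funpow[OF graded_ops(3)[OF m], of a] graded_funpow[OF graded_ops(1)[OF m], of b]]]]
      by simp
qed

lemma graded_Pi_ij:
  assumes m: "m > 4"
  shows "graded m (real j - real i) (- real j - real i) (Pi_ij m p q i j)"
  unfolding Pi_ij_def Let_def map_mult_scal
  using graded_comp[OF graded_Pi_kl[OF m] graded_comp[OF graded_funpow[OF graded_ops(3)[OF m], of i]
        graded_funpow[OF graded_ops(1)[OF m], of j]]]
  by (intro graded_scal) simp

lemma Pi_ij_component:
  assumes m: "m > 4" and "q \<le> p" "i \<le> q" "j \<le> q - i" "a \<le> q" "b \<le> q - a"
    and H: "simp_harm m (p - a + b) (q - a - b) H"
  shows "harm m 0 m (real p) (real q) ((C_op m ^^ a) ((S_u m ^^ b) H))"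
    and "Pi_ij m p q i j ((C_op m ^^ a) ((S_u m ^^ b) H)) = (if a = i \<and> b = j then H else 0)"
proof -
  interpret simplicial m "p - a + b" "q - a - b" H using m H by unfold_locales
  have v: "(C_op m ^^ a) ((S_u m ^^ b) H) = v a b" by (simp add: v_def)
  have "real (p - a + b) + real a - real b = real p" "real (q - a - b) + real a + real b = real q"
    using assms by auto
  then show "harm m 0 m (real p) (real q) ((C_op m ^^ a) ((S_u m ^^ b) H))"
    unfolding v using harm_v[of a b] by simp
  define K where "K = p - i + j"
  define L where "L = q - i - j"
  have bk: "b \<le> p - a + b" by simp
  have Pi: "graded m 0 0 (Pi_kl m K L)" by (rule graded_Pi_kl[OF m])
  have Pi_ij: "Pi_ij m p q i j P = scal (1 / alpha_coef m i j K L)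
      * Pi_kl m K L ((A_op m ^^ i) ((S_x m ^^ j) P))" for P
    unfolding Pi_ij_def map_mult_scal Let_def K_def L_def ..
  show "Pi_ij m p q i j ((C_op m ^^ a) ((S_u m ^^ b) H)) = (if a = i \<and> b = j then H else 0)"
  proof (cases "a < i \<or> b < j")
    case True
    then show ?thesis
      unfolding v Pi_ij A_pow_S_x_pow_v_zero[OF bk True] using graded_0[OF Pi] by auto
  next
    case False
    \<comment> \<open>The lowered vector \<open>v (a - i) (b - j)\<close> lies in bidegree (K, L),
      the one for which \<open>Pi_kl\<close> was built; \<open>L \<le> K\<close> follows from q
      \<le> p.\<close>
    then have "K + (b - j) = (p - a + b) + (a - i)" "L = q - a - b + (a - i) + (b - j)" "L \<le> K"
      using assms by (auto simp: K_def L_def)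
    then have *: "Pi_kl m K L (v (a - i) (b - j)) = (if a - i = 0 \<and> b - j = 0 then H else 0)"
      by (intro Pi_kl_v) auto
    show ?thesis
    proof (cases "a = i \<and> b = j")
      case True
      then have KL: "K = p - a + b" "L = q - a - b" by (auto simp: K_def L_def)
      have "alpha_coef m i j K L > 0"
        unfolding KL using True assms by (intro alpha_coef_pos) auto
      moreover have "Pi_kl m K L ((A_op m ^^ i) ((S_x m ^^ j) (v a b))) = scal (alpha_coef m i j K L) * H"
        unfolding A_pow_S_x_pow_v[OF bk] gradedD(2)[OF Pi harm_v] *
        using True alpha_coef_eq[of i j] KL by simp
      ultimately show ?thesis
        unfolding v Pi_ij using True by (simp add: mult.assoc[symmetric] scal_mult[symmetric])
    next
      case no: False
      then have "Pi_kl m K L ((A_op m ^^ i) ((S_x m ^^ j) (v a b))) = 0"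
        unfolding A_pow_S_x_pow_v[OF bk] gradedD(2)[OF Pi harm_v] * using False by auto
      then show ?thesis unfolding v Pi_ij using no by auto
    qed
  qed
qed

theorem theorem4p3:
  fixes m p q i j :: nat and P :: cpoly and H :: "nat \<Rightarrow> nat \<Rightarrow> cpoly"
  assumes "m > 4"
    and "q \<le> p"
    and "i \<le> q" and "j \<le> q - i"
    and "harm2 m p q P"
    and "\<forall>a\<le>q. \<forall>b\<le>q - a. simp_harm m (p - a + b) (q - a - b) (H a b)"
    and "P = (\<Sum>a\<le>q. \<Sum>b\<le>q - a. (C_op m ^^ a) ((S_u m ^^ b) (H a b)))"
  shows "Pi_ij m p q i j P = H i j"
proof -
  note Pi = graded_Pi_ij[OF assms(1), of j i p q]
  let ?f = "\<lambda>a b. (C_op m ^^ a) ((S_u m ^^ b) (H a b))"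
  \<comment> \<open>The common bidegree (p, q) of all components is what allows \<open>Pi_ij\<close>
    to be taken through the two sums.\<close>
  have comp: "harm m 0 m (real p) (real q) (?f a b)"
    "Pi_ij m p q i j (?f a b) = (if a = i \<and> b = j then H a b else 0)" if "a \<le> q" "b \<le> q - a" for a b
    using Pi_ij_component[OF assms(1-4) that] assms(6) that by blast+
  have "Pi_ij m p q i j P = (\<Sum>a\<le>q. Pi_ij m p q i j (\<Sum>b\<le>q - a. ?f a b))"
    unfolding assms(7) by (intro graded_sum(1)[OF Pi] graded_sum(2)[OF Pi]) (use comp(1) in auto)
  also have "\<dots> = (\<Sum>a\<le>q. \<Sum>b\<le>q - a. Pi_ij m p q i j (?f a b))"
    by (intro sum.cong refl graded_sum(1)[OF Pi]) (use comp(1) in auto)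
  also have "\<dots> = (\<Sum>a\<le>q. \<Sum>b\<le>q - a. if a = i \<and> b = j then H a b else 0)"
    using comp(2) by (intro sum.cong refl) auto
  also have "\<dots> = (\<Sum>a\<le>q. if a = i then H i j else 0)"
    using assms(4) by (intro sum.cong refl) auto
  also have "\<dots> = H i j" using assms(3) by simp
  finally show ?thesis .
qed

end
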